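(* Let $D$ be a strongly connected balanced bipartite digraph of order $2a$, where $a\geq 3$, and let $k$ be an integer satisfying $\max\{1,\frac{a}{4}\}<k\leq\frac{a}{2}$. Suppose that for every dominating pair $\{u,v\}$ of vertices in $D$, \[ d(u)\geq 2a-k\ \text{and}\ d(v)\geq a+k,\quad\text{or}\quad d(u)\geq a+k\ \text{and}\ d(v)\geq 2a-k. \] Then $D$ is either bipancyclic or a directed cycle of length $2a$.
   Context: Digraphs have no loops and no multiple arcs (2-cycles $uv, vu$ are allowed). For a vertex $v$, $d^+(v)$ and $d^-(v)$ are its out- and in-degree, and $d(v)=d^+(v)+d^-(v)$. A pair of distinct vertices $\{u,v\}$ is dominating if there is a vertex $w$ with $uw$ and $vw$ both arcs of $D$. A bipartite digraph is balanced if its two partite sets have equal size. A balanced bipartite digraph is bipancyclic if it contains directed cycles of all even lengths $2,4,\dots,|V(D)|$. *)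

theory Defs
  imports Complex_Main "Graph_Theory.Arc_Walk" "Graph_Theory.Digraph_Component"
begin

definition total_degree :: "('a, 'b) pre_digraph \<Rightarrow> 'a \<Rightarrow> nat" where
  "total_degree D v = out_degree D v + in_degree D v"

definition dominating_pair :: "('a, 'b) pre_digraph \<Rightarrow> 'a \<Rightarrow> 'a \<Rightarrow> bool" where
  "dominating_pair D u v \<longleftrightarrow>
     u \<in> verts D \<and> v \<in> verts D \<and> u \<noteq> v \<and>
     (\<exists>w \<in> verts D. u \<rightarrow>\<^bsub>D\<^esub> w \<and> v \<rightarrow>\<^bsub>D\<^esub> w)"

definition bipartition :: "('a, 'b) pre_digraph \<Rightarrow> 'a set \<Rightarrow> 'a set \<Rightarrow> bool" where
  "bipartition D X Y \<longleftrightarrow>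
     X \<union> Y = verts D \<and> X \<inter> Y = {} \<and>
     (\<forall>e \<in> arcs D. tail D e \<in> X \<and> head D e \<in> Y \<or> tail D e \<in> Y \<and> head D e \<in> X)"

definition balanced_bipartite :: "('a, 'b) pre_digraph \<Rightarrow> bool" where
  "balanced_bipartite D \<longleftrightarrow> (\<exists>X Y. bipartition D X Y \<and> card X = card Y)"

text \<open>
  A \<^const>\<open>pre_digraph.cycle\<close> is a nonempty list of consecutive arcs, so its length is the
  number of its arcs; a 2-cycle \<open>uv, vu\<close> counts as a cycle of length 2.
\<close>

definition bipancyclic :: "('a, 'b) pre_digraph \<Rightarrow> bool" where
  "bipancyclic D \<longleftrightarrow>
     (\<forall>n. even n \<and> 2 \<le> n \<and> n \<le> card (verts D) \<longrightarrow>
        (\<exists>p. pre_digraph.cycle D p \<and> length p = n))"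

text \<open>The digraph itself is a directed cycle: it has no vertices or arcs outside the cycle.\<close>

definition is_directed_cycle :: "('a, 'b) pre_digraph \<Rightarrow> nat \<Rightarrow> bool" where
  "is_directed_cycle D n \<longleftrightarrow>
     (\<exists>p. pre_digraph.cycle D p \<and> length p = n \<and>
        arcs D = set p \<and> verts D = tail D ` set p)"

end

theory Submission
  imports Defs "HOL-Combinatorics.Cycles"
begin

text \<open>
  A vertex in no dominating pair has only out-neighbours of in-degree 1, whose degree is at most
  \<open>a + 1 < a + k\<close>, so these are in no dominating pair either; by strong connectivity all in-degrees
  are 1 and the digraph is a directed cycle. Otherwise all degrees are at least \<open>a + k\<close>, and in each
  partite set the vertices of degree below \<open>2a - k\<close> have pairwise disjoint out-neighbourhoods.

  Hall's theorem then gives a cycle factor; take one with the fewest cycles. Two of its cycles with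
  successor map \<open>f\<close> merge as soon as \<open>u \<rightarrow> f w\<close> and \<open>w \<rightarrow> f u\<close> for some \<open>u\<close> and \<open>w\<close> on them, so at most
  half of the possible arcs leave or enter a given cycle. Comparing this with the degree
  sum over a shortest cycle leaves only \<open>a = 2k\<close> and two complete halves, where strong connectivity
  yields a Hamiltonian cycle.

  On a Hamiltonian cycle \<open>\<dots>, u, y, x, p, \<dots>\<close> where \<open>u\<close> has many out-neighbours and \<open>p\<close> many
  in-neighbours, either \<open>u \<rightarrow> p\<close> or the digraph without \<open>x\<close> and \<open>y\<close> splits into two cycles; the same
  count, strengthened by the absent chords \<open>v \<rightarrow> f (f (f v))\<close>, shows that they merge. So there is a
  cycle of length \<open>2a - 2\<close>. A vertex off it has more than \<open>a - 1\<close> arcs to and from it, so a pigeonhole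
  argument produces cycles of all shorter even lengths through that vertex.
\<close>

section \<open>Cycles as lists\<close>

text \<open>
  The equation \<open>map f xs = rotate1 xs\<close> says that \<open>f\<close> sends each entry of the cyclic list \<open>xs\<close> to the
  next one.
\<close>

definition cyc :: "('a \<Rightarrow> 'a \<Rightarrow> bool) \<Rightarrow> 'a list \<Rightarrow> bool" where
  "cyc E xs \<longleftrightarrow> xs \<noteq> [] \<and> distinct xs \<and> successively E xs \<and> E (last xs) (hd xs)"

lemma cyc_rotate: "cyc E (us @ vs) \<Longrightarrow> cyc E (vs @ us)"
  by (cases "us = [] \<or> vs = []") (auto simp: cyc_def successively_append_iff)

lemma succ_rotate:
  assumes "map f (us @ vs) = rotate1 (us @ vs)"
  shows "map f (vs @ us) = rotate1 (vs @ us)"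
proof -
  have "map f (rotate (length us) (us @ vs)) = rotate1 (rotate (length us) (us @ vs))"
    using assms by (simp only: rotate_map[symmetric] rotate1_rotate_swap)
  then show ?thesis by (simp only: rotate_append)
qed

lemma succ_split:
  assumes "map f (us @ w # vs) = rotate1 (us @ w # vs)"
  shows "f w = hd (vs @ us @ [w])"
proof -
  have "map f ((w # vs) @ us) = rotate1 ((w # vs) @ us)"
    using succ_rotate[OF assms] .
  then show ?thesis by (cases vs; cases us) auto
qed

lemma succ_bij:
  assumes "map f xs = rotate1 xs"
  shows "bij_betw f (set xs) (set xs)"
proof -
  have "f ` set xs = set xs" by (metis assms set_map set_rotate1)
  then show ?thesis by (simp add: bij_betw_def eq_card_imp_inj_on)
qed

lemma cyc_succ:
  assumes "cyc E xs" and "map f xs = rotate1 xs" and "v \<in> set xs"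
  shows "E v (f v)"
proof -
  obtain us vs where xs: "xs = us @ v # vs" using assms(3) by (meson split_list)
  have "f v = hd (vs @ us @ [v])" using assms(2) succ_split unfolding xs by metis
  moreover have "cyc E ((vs @ us) @ [v])" using cyc_rotate[of E "us @ [v]" vs] assms(1) xs by simp
  ultimately show ?thesis unfolding cyc_def by simp
qed

text \<open>Opens the cycle at the arc from \<open>w\<close> to \<open>f w\<close>: cutting that arc
  leaves a path from \<open>f w\<close> to \<open>w\<close>, the form in which cycles are joined or
  shortened below.\<close>

lemma cyc_ending_at:
  assumes "cyc E xs" and "map f xs = rotate1 xs" and "w \<in> set xs"
  obtains us where "cyc E (us @ [w])" "set (us @ [w]) = set xs" "length (us @ [w]) = length xs"
    "hd (us @ [w]) = f w" "map f (us @ [w]) = rotate1 (us @ [w])"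
proof -
  obtain us vs where xs: "xs = us @ w # vs" using assms(3) by (meson split_list)
  have 1: "f w = hd (vs @ us @ [w])" using assms(2) succ_split unfolding xs by metis
  have 2: "cyc E ((vs @ us) @ [w])" using cyc_rotate[of E "us @ [w]" vs] assms(1) xs by simp
  have 3: "map f ((vs @ us) @ [w]) = rotate1 ((vs @ us) @ [w])"
    using succ_rotate[of f "us @ [w]" vs] assms(2) xs by simp
  show thesis by (rule that[OF 2 _ _ _ 3]) (use xs 1 in auto)
qed

lemma cyc_of_succ:
  assumes "xs \<noteq> []" "distinct xs" "map f xs = rotate1 xs" "\<And>v. v \<in> set xs \<Longrightarrow> E v (f v)"
  shows "cyc E xs"
proof -
  have *: "E (xs ! i) (xs ! (Suc i mod length xs))" if "i < length xs" for i
  proof -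
    have "f (xs ! i) = xs ! (Suc i mod length xs)"
      using that assms(3) by (metis nth_map nth_rotate1)
    then show ?thesis using assms(4) that nth_mem by metis
  qed
  have "successively E xs"
    unfolding successively_conv_nth using * by (metis Suc_lessD mod_less)
  moreover have "E (last xs) (hd xs)"
    using *[of "length xs - 1"] assms(1) by (simp add: last_conv_nth hd_conv_nth)
  ultimately show ?thesis using assms by (simp add: cyc_def)
qed

text \<open>Disjointness lets one successor map serve all cycles of a family at once; a singleton
  family gives the successor map of a single cycle.\<close>

lemma ex_succ:
  assumes "pairwise (\<lambda>xs ys. set xs \<inter> set ys = {}) F" and "\<And>xs. xs \<in> F \<Longrightarrow> distinct xs"
  shows "\<exists>f. \<forall>xs \<in> F. map f xs = rotate1 xs"
proof (intro exI ballI)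
  let ?f = "\<lambda>v. cycle_of_list (SOME xs. xs \<in> F \<and> v \<in> set xs) v"
  fix xs assume xs: "xs \<in> F"
  have "(SOME ys. ys \<in> F \<and> v \<in> set ys) = xs" if "v \<in> set xs" for v
    using assms(1) xs that by (intro some_equality) (auto simp: pairwise_def)
  then have "map ?f xs = map (cycle_of_list xs) xs" by simp
  also have "\<dots> = rotate1 xs" using cyclic_rotation[of xs 1] assms(2)[OF xs] by simp
  finally show "map ?f xs = rotate1 xs" .
qed

text \<open>The successors of \<open>u\<close> and \<open>w\<close> are exchanged: both cycles are
  cut open after these vertices and the two paths are joined crosswise.\<close>

lemma cyc_merge:
  assumes "cyc E xs" "map f xs = rotate1 xs" "cyc E ys" "map f ys = rotate1 ys"
    and "set xs \<inter> set ys = {}" and "u \<in> set xs" "w \<in> set ys" "E u (f w)" "E w (f u)"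
  obtains zs where "cyc E zs" "set zs = set xs \<union> set ys"
proof -
  obtain us where us: "cyc E (us @ [u])" "set (us @ [u]) = set xs" "hd (us @ [u]) = f u"
    using cyc_ending_at[OF assms(1,2,6)] by metis
  obtain ws where ws: "cyc E (ws @ [w])" "set (ws @ [w]) = set ys" "hd (ws @ [w]) = f w"
    using cyc_ending_at[OF assms(3,4,7)] by metis
  have "cyc E ((us @ [u]) @ (ws @ [w]))"
    using us ws assms(5,8,9) unfolding cyc_def
    by (subst successively_append_iff) (auto simp: hd_append)
  then show thesis using that us(2) ws(2) by (metis set_append)
qed

text \<open>Since \<open>v\<close> stands last, index \<open>0\<close> already holds
  \<open>f v\<close>; hence the exponent \<open>Suc i\<close>.\<close>

lemma nth_cyclic_list:
  assumes "map f (us @ [v]) = rotate1 (us @ [v])" and "i < length (us @ [v])"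
  shows "(us @ [v]) ! i = (f ^^ Suc i) v"
  using assms(2)
proof (induction i)
  case 0
  show ?case using succ_split[of f us v "[]"] assms(1) by (simp add: hd_conv_nth)
next
  case (Suc i)
  have "f ((us @ [v]) ! i) = rotate1 (us @ [v]) ! i"
    using assms(1) Suc.prems by (metis Suc_lessD nth_map)
  also have "\<dots> = (us @ [v]) ! Suc i"
    using Suc.prems by (simp only: nth_rotate1 Suc_lessD mod_less)
  finally show ?case using Suc by simp
qed

section \<open>Cycle factors and permutations\<close>

definition cycle_factor :: "('a \<Rightarrow> 'a \<Rightarrow> bool) \<Rightarrow> 'a set \<Rightarrow> 'a list set \<Rightarrow> bool" where
  "cycle_factor E V F \<longleftrightarrow> finite F \<and> pairwise (\<lambda>xs ys. set xs \<inter> set ys = {}) F \<and>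
    \<Union> (set ` F) = V \<and> (\<forall>xs \<in> F. cyc E xs)"

text \<open>The cycles of \<open>f\<close>, regarded as a permutation, form the factor; the
  induction runs along its decomposition into disjoint cycles.\<close>

lemma ex_cycle_factor:
  assumes "finite V" and "bij_betw f V V" and "\<And>v. v \<in> V \<Longrightarrow> E v (f v)"
  shows "\<exists>F. cycle_factor E V F"
proof -
  have *: "\<exists>F. finite F \<and> pairwise (\<lambda>xs ys. set xs \<inter> set ys = {}) F \<and> \<Union> (set ` F) = V \<and>
      (\<forall>xs \<in> F. xs \<noteq> [] \<and> distinct xs \<and> map p xs = rotate1 xs) \<and> (\<forall>v. v \<notin> V \<longrightarrow> p v = v)"
    if "cycle_decomp V p" for V :: "'a set" and p
    using that
  proof induction
    case empty
    show ?case by (intro exI[of _ "{}"]) simp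
  next
    case (comp I p cs)
    then obtain F where F: "finite F" "pairwise (\<lambda>xs ys. set xs \<inter> set ys = {}) F" "\<Union> (set ` F) = I"
      "\<And>xs. xs \<in> F \<Longrightarrow> xs \<noteq> [] \<and> distinct xs \<and> map p xs = rotate1 xs" "\<And>v. v \<notin> I \<Longrightarrow> p v = v"
      by auto
    let ?q = "cycle_of_list cs \<circ> p"
    have 1: "map ?q xs = rotate1 xs" if "xs \<in> F" for xs
    proof -
      have "map ?q xs = map (cycle_of_list cs) (rotate1 xs)"
        using F(4) that by (metis map_map)
      also have "\<dots> = rotate1 xs"
      proof (rule map_idI)
        fix v assume "v \<in> set (rotate1 xs)"
        then have "v \<in> I" using F(3) that by auto
        then have "v \<notin> set cs" using comp.hyps by auto
        then show "cycle_of_list cs v = v" by (rule id_outside_supp)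
      qed
      finally show ?thesis .
    qed
    have "map ?q cs = map (cycle_of_list cs) cs"
      using comp.hyps F(5) by (auto intro!: arg_cong[of _ _ "cycle_of_list cs"])
    also have "\<dots> = rotate1 cs" using cyclic_rotation[of cs 1] comp.hyps by simp
    finally have 2: "map ?q cs = rotate1 cs" .
    have 3: "?q v = v" if "v \<notin> set cs \<union> I" for v
      using that F(5) id_outside_supp[of v cs] by simp
    have 4: "pairwise (\<lambda>xs ys. set xs \<inter> set ys = {}) (insert cs F)"
      unfolding pairwise_insert using F comp.hyps by blast
    \<comment> \<open>The decomposition may contain the empty list as a cycle; \<open>cyc\<close>
      excludes it, so it is left out of the family.\<close>
    show ?case
      by (intro exI[of _ "if cs = [] then F else insert cs F"])
        (use F(1-4) 1 2 3 4 comp.hyps in \<open>auto simp del: map_map comp_apply\<close>)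
  qed
  let ?p = "\<lambda>v. if v \<in> V then f v else v"
  have "bij_betw ?p V V" using assms(2) by (subst bij_betw_cong[of V ?p f]) auto
  then have "?p permutes V" by (rule bij_imp_permutes) auto
  then have "cycle_decomp V ?p" using cycle_decomposition assms(1) by blast
  from *[OF this] obtain F where F: "finite F" "pairwise (\<lambda>xs ys. set xs \<inter> set ys = {}) F"
      "\<Union> (set ` F) = V" "\<forall>xs \<in> F. xs \<noteq> [] \<and> distinct xs \<and> map ?p xs = rotate1 xs" by auto
  have "cyc E xs" if "xs \<in> F" for xs
    by (rule cyc_of_succ[of xs ?p]) (use F(3,4) that assms(3) in auto)
  then show ?thesis using F unfolding cycle_factor_def by blast
qed

section \<open>Hall's theorem\<close>

text \<open>Induction on \<open>X\<close>. If some proper nonempty \<open>J\<close> is tight, it is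
  matched first, and the condition survives for the rest after the neighbours of \<open>J\<close>
  are deleted. Otherwise every proper nonempty subset has a spare neighbour, so \<open>x\<close> may
  take any neighbour \<open>y\<close>.\<close>

lemma hall_marriage:
  fixes N :: "'a \<Rightarrow> 'b set"
  assumes "finite X" and "\<And>S. S \<subseteq> X \<Longrightarrow> card S \<le> card (\<Union>u\<in>S. N u)"
    and "\<And>u. u \<in> X \<Longrightarrow> finite (N u)"
  shows "\<exists>f. inj_on f X \<and> (\<forall>u \<in> X. f u \<in> N u)"
  using assms
proof (induction X arbitrary: N rule: finite_psubset_induct)
  case (psubset X)
  show ?case
  proof (cases "X = {}")
    case True
    then show ?thesis by simp
  next
    case False
    then obtain x where x: "x \<in> X" by blast
    show ?thesis
    proof (cases "\<exists>J. J \<subset> X \<and> J \<noteq> {} \<and> card (\<Union>u\<in>J. N u) \<le> card J")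
      case True
      then obtain J where J: "J \<subset> X" "J \<noteq> {}" "card (\<Union>u\<in>J. N u) \<le> card J" by blast
      have finJ: "finite J" using J psubset.hyps finite_subset by blast
      let ?M = "\<Union>u\<in>J. N u"
      have "\<exists>f. inj_on f J \<and> (\<forall>u \<in> J. f u \<in> N u)"
        by (rule psubset.IH) (use J psubset.prems in auto)
      then obtain f where f: "inj_on f J" "\<forall>u \<in> J. f u \<in> N u" by blast
      have finM: "finite ?M" using finJ J psubset.prems by auto
      have "\<exists>g. inj_on g (X - J) \<and> (\<forall>u \<in> X - J. g u \<in> N u - ?M)"
      proof (rule psubset.IH)
        show "X - J \<subset> X" using J by blast
        show "card S \<le> card (\<Union>u\<in>S. N u - ?M)" if S: "S \<subseteq> X - J" for S
        proof -
          have finS: "finite S" using S psubset.hyps finite_subset by blast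
          \<comment> \<open>Hall's condition is applied to \<open>S\<close> together with
            \<open>J\<close>; tightness of \<open>J\<close> then cancels its share.\<close>
          have "card S + card J = card (S \<union> J)"
            using S finS finJ by (intro card_Un_disjoint[symmetric]) auto
          also have "\<dots> \<le> card (\<Union>u\<in>S \<union> J. N u)" using S J by (intro psubset.prems) auto
          also have "(\<Union>u\<in>S \<union> J. N u) = (\<Union>u\<in>S. N u - ?M) \<union> ?M" by auto
          also have "card \<dots> \<le> card (\<Union>u\<in>S. N u - ?M) + card ?M" by (rule card_Un_le)
          finally show ?thesis using J by linarith
        qed
      qed (use psubset.prems in auto)
      then obtain g where g: "inj_on g (X - J)" "\<forall>u \<in> X - J. g u \<in> N u - ?M" by blast
      let ?h = "\<lambda>u. if u \<in> J then f u else g u"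
      have "inj_on ?h X"
      proof (rule inj_onI)
        fix u v assume uv: "u \<in> X" "v \<in> X" "?h u = ?h v"
        consider "u \<in> J" "v \<in> J" | "u \<notin> J" "v \<notin> J" | "u \<in> J" "v \<notin> J" | "u \<notin> J" "v \<in> J" by blast
        then show "u = v"
        proof cases
          case 1
          then show ?thesis using uv f(1) by (auto dest: inj_onD)
        next
          case 2
          then show ?thesis using uv g(1) by (auto dest: inj_onD)
        next
          case 3
          then have "f u = g v" using uv by simp
          then show ?thesis using 3 uv f(2) g(2) by (metis DiffD2 DiffI UN_I)
        next
          case 4
          then have "g u = f v" using uv by simp
          then show ?thesis using 4 uv f(2) g(2) by (metis DiffD2 DiffI UN_I)
        qed
      qed
      moreover have "\<forall>u \<in> X. ?h u \<in> N u" using f g by auto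
      ultimately show ?thesis by blast
    next
      case tight: False
      have "card {x} \<le> card (N x)" using psubset.prems(1)[of "{x}"] x by simp
      then obtain y where y: "y \<in> N x" by fastforce
      have "\<exists>g. inj_on g (X - {x}) \<and> (\<forall>u \<in> X - {x}. g u \<in> N u - {y})"
      proof (rule psubset.IH)
        show "X - {x} \<subset> X" using x by blast
        show "card S \<le> card (\<Union>u\<in>S. N u - {y})" if S: "S \<subseteq> X - {x}" for S
        proof (cases "S = {}")
          case False
          moreover have "S \<subset> X" using S x by blast
          ultimately have "card S < card (\<Union>u\<in>S. N u)" using tight not_less by blast
          moreover have "(\<Union>u\<in>S. N u - {y}) = (\<Union>u\<in>S. N u) - {y}" by auto
          moreover have "card (\<Union>u\<in>S. N u) - 1 \<le> card ((\<Union>u\<in>S. N u) - {y})"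
            using diff_card_le_card_Diff[of "{y}" "\<Union>u\<in>S. N u"] by simp
          ultimately show ?thesis by simp
        qed simp
      qed (use psubset.prems in auto)
      then obtain g where g: "inj_on g (X - {x})" "\<forall>u \<in> X - {x}. g u \<in> N u - {y}" by blast
      let ?h = "g(x := y)"
      have "inj_on ?h X" using g unfolding inj_on_def by auto
      moreover have "\<forall>u \<in> X. ?h u \<in> N u" using g y by auto
      ultimately show ?thesis by blast
    qed
  qed
qed

section \<open>Counting arcs\<close>

text \<open>Integer-valued, so that differences in the degree estimates are not truncated.\<close>

definition arcs_between :: "('a \<Rightarrow> 'a \<Rightarrow> bool) \<Rightarrow> 'a set \<Rightarrow> 'a set \<Rightarrow> int" where
  "arcs_between E A B = (\<Sum>u\<in>A. \<Sum>v\<in>B. of_bool (E u v))"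

definition deg :: "('a \<Rightarrow> 'a \<Rightarrow> bool) \<Rightarrow> 'a set \<Rightarrow> 'a \<Rightarrow> int" where
  "deg E V v = arcs_between E {v} V + arcs_between E V {v}"

lemma arcs_between_Un_left:
  "finite A \<Longrightarrow> finite B \<Longrightarrow> A \<inter> B = {} \<Longrightarrow>
    arcs_between E (A \<union> B) C = arcs_between E A C + arcs_between E B C"
  unfolding arcs_between_def by (rule sum.union_disjoint)

lemma arcs_between_Un_right:
  "finite A \<Longrightarrow> finite B \<Longrightarrow> A \<inter> B = {} \<Longrightarrow>
    arcs_between E C (A \<union> B) = arcs_between E C A + arcs_between E C B"
  unfolding arcs_between_def by (simp add: sum.union_disjoint sum.distrib del: sum_of_bool_eq)

lemma sum_arcs_between_left: "(\<Sum>u\<in>A. arcs_between E {u} B) = arcs_between E A B"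
  unfolding arcs_between_def by simp

lemma sum_arcs_between_right: "(\<Sum>v\<in>B. arcs_between E A {v}) = arcs_between E A B"
  unfolding arcs_between_def by (subst (2) sum.swap) (simp del: sum_of_bool_eq)

lemma arcs_between_out: "finite B \<Longrightarrow> arcs_between E {v} B = int (card {w \<in> B. E v w})"
  unfolding arcs_between_def by (simp add: of_bool_def sum.If_cases Int_def)

lemma arcs_between_in: "finite A \<Longrightarrow> arcs_between E A {v} = int (card {u \<in> A. E u v})"
  by (simp add: arcs_between_def Int_def del: sum_of_bool_eq) (simp add: Int_def)

lemma arcs_between_missing:
  assumes "finite A" "finite B"
  shows "arcs_between E A B + int (card {(u, v) \<in> A \<times> B. \<not> E u v}) = int (card A) * int (card B)"
proof -
  have "arcs_between E A B = (\<Sum>p\<in>A \<times> B. of_bool (E (fst p) (snd p)))"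
    unfolding arcs_between_def by (simp add: sum.cartesian_product case_prod_beta)
  moreover have "int (card {(u, v) \<in> A \<times> B. \<not> E u v}) = (\<Sum>p\<in>A \<times> B. of_bool (\<not> E (fst p) (snd p)))"
  proof -
    have "{(u, v) \<in> A \<times> B. \<not> E u v} = {p \<in> A \<times> B. \<not> E (fst p) (snd p)}" by auto
    then show ?thesis using assms by (simp add: of_bool_def sum.If_cases Int_def)
  qed
  ultimately have "arcs_between E A B + int (card {(u, v) \<in> A \<times> B. \<not> E u v})
      = (\<Sum>p\<in>A \<times> B. of_bool (E (fst p) (snd p)) + of_bool (\<not> E (fst p) (snd p)))"
    by (simp only: sum.distrib)
  also have "\<dots> = (\<Sum>p\<in>A \<times> B. 1)" by (intro sum.cong) auto
  finally have "arcs_between E A B + int (card {(u, v) \<in> A \<times> B. \<not> E u v}) = (\<Sum>p\<in>A \<times> B. 1)" .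
  then show ?thesis by (simp add: card_cartesian_product)
qed

lemma arcs_between_le:
  "finite A \<Longrightarrow> finite B \<Longrightarrow> arcs_between E A B \<le> int (card A) * int (card B)"
  by (drule (1) arcs_between_missing[where E = E]) linarith

lemma arcs_between_less:
  assumes "finite A" "finite B" "u \<in> A" "v \<in> B" "\<not> E u v"
  shows "arcs_between E A B < int (card A) * int (card B)"
proof -
  have "finite {(u, v) \<in> A \<times> B. \<not> E u v}"
    by (rule finite_subset[of _ "A \<times> B"]) (use assms in auto)
  then have "0 < card {(u, v) \<in> A \<times> B. \<not> E u v}"
    using assms by (auto simp: card_gt_0_iff)
  then show ?thesis using arcs_between_missing[OF assms(1,2), of E] by linarith
qed

lemma arcs_between_eq_0_iff:
  "finite A \<Longrightarrow> finite B \<Longrightarrow> arcs_between E A B = 0 \<longleftrightarrow> (\<forall>u\<in>A. \<forall>v\<in>B. \<not> E u v)"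
  unfolding arcs_between_def by (auto simp: sum_nonneg_eq_0_iff sum_nonneg)

text \<open>Each pair \<open>(u, w)\<close> contributes at most one of the two arcs that
  \<open>cyc_merge\<close> requires, and injectivity of \<open>f\<close> makes the pairs count every
  arc once.\<close>

lemma arcs_between_no_swap:
  assumes "finite A" "finite B" "inj_on f A" "inj_on f B"
    and "\<And>u w. u \<in> A \<Longrightarrow> w \<in> B \<Longrightarrow> \<not> (E u (f w) \<and> E w (f u))"
  shows "arcs_between E A (f ` B) + arcs_between E B (f ` A) \<le> int (card A) * int (card B)"
proof -
  have 1: "arcs_between E A (f ` B) = (\<Sum>u\<in>A. \<Sum>w\<in>B. of_bool (E u (f w)))"
    unfolding arcs_between_def by (simp add: sum.reindex assms del: sum_of_bool_eq)
  have 2: "arcs_between E B (f ` A) = (\<Sum>u\<in>A. \<Sum>w\<in>B. of_bool (E w (f u)))"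
    unfolding arcs_between_def by (simp add: sum.reindex assms del: sum_of_bool_eq) (rule sum.swap)
  have "(\<Sum>u\<in>A. \<Sum>w\<in>B. of_bool (E u (f w)) + of_bool (E w (f u)) :: int) \<le> (\<Sum>u\<in>A. \<Sum>w\<in>B. 1)"
    by (intro sum_mono) (use assms(5) in \<open>auto simp: of_bool_def\<close>)
  then show ?thesis unfolding 1 2 by (simp add: sum.distrib)
qed

section \<open>Degrees below \<open>2a - k\<close> and unmergeable cycles\<close>

text \<open>
  Assumption \<open>deg_ge\<close> covers every vertex because the case of a vertex in no dominating pair is
  treated separately; \<open>dom\<close> is what remains of the degree condition.
\<close>

locale dominating_bipartite =
  fixes E :: "'a \<Rightarrow> 'a \<Rightarrow> bool" and X Y :: "'a set" and a k :: int
  assumes finX: "finite X" and finY: "finite Y"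
    and cardX: "int (card X) = a" and cardY: "int (card Y) = a"
    and disj: "X \<inter> Y = {}"
    and arc: "E u v \<Longrightarrow> u \<in> X \<and> v \<in> Y \<or> u \<in> Y \<and> v \<in> X"
    and k2: "2 \<le> k" and ka: "2 * k \<le> a" and ak: "a < 4 * k"
    and deg_ge: "v \<in> X \<union> Y \<Longrightarrow> a + k \<le> deg E (X \<union> Y) v"
    and dom: "E u w \<Longrightarrow> E v w \<Longrightarrow> u \<noteq> v \<Longrightarrow>
      2 * a - k \<le> deg E (X \<union> Y) u \<or> 2 * a - k \<le> deg E (X \<union> Y) v"
    and strong: "A \<subseteq> X \<union> Y \<Longrightarrow> A \<noteq> {} \<Longrightarrow> A \<noteq> X \<union> Y \<Longrightarrow> \<exists>u\<in>A. \<exists>v\<in>X \<union> Y - A. E u v"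
begin

abbreviation "V \<equiv> X \<union> Y"
abbreviation "ab \<equiv> arcs_between E"
abbreviation "d \<equiv> deg E V"

lemma finV: "finite V" using finX finY by simp

text \<open>The hypotheses are symmetric in the partite sets, so facts proved for \<open>X\<close>
  carry over to \<open>Y\<close> by interpretation.\<close>

lemma swap: "dominating_bipartite E Y X a k"
proof
  have c: "Y \<union> X = V" by (rule Un_commute)
  show "Y \<inter> X = {}" using disj by blast
  show "E u v \<Longrightarrow> u \<in> Y \<and> v \<in> X \<or> u \<in> X \<and> v \<in> Y" for u v using arc by blast
  show "v \<in> Y \<union> X \<Longrightarrow> a + k \<le> deg E (Y \<union> X) v" for v unfolding c by (rule deg_ge)
  show "E u w \<Longrightarrow> E v w \<Longrightarrow> u \<noteq> v \<Longrightarrow>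
      2 * a - k \<le> deg E (Y \<union> X) u \<or> 2 * a - k \<le> deg E (Y \<union> X) v" for u v w
    unfolding c by (rule dom)
  show "A \<subseteq> Y \<union> X \<Longrightarrow> A \<noteq> {} \<Longrightarrow> A \<noteq> Y \<union> X \<Longrightarrow> \<exists>u\<in>A. \<exists>v\<in>Y \<union> X - A. E u v" for A
    unfolding c by (rule strong)
qed (use finX finY cardX cardY k2 ka ak in auto)

lemma ab_split:
  assumes "S \<subseteq> V" "T \<subseteq> V"
  shows "ab S T = ab (S \<inter> X) (T \<inter> Y) + ab (S \<inter> Y) (T \<inter> X)"
proof -
  have fin: "finite S" "finite T" using assms finV finite_subset by auto
  have "ab S T = ab (S \<inter> X \<union> S \<inter> Y) (T \<inter> X \<union> T \<inter> Y)"
    using assms by (metis Int_Un_distrib inf.absorb1)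
  also have "\<dots> = ab (S \<inter> X) (T \<inter> X) + ab (S \<inter> X) (T \<inter> Y)
      + (ab (S \<inter> Y) (T \<inter> X) + ab (S \<inter> Y) (T \<inter> Y))"
    using fin disj by (subst arcs_between_Un_left, (auto)[3], (subst arcs_between_Un_right, (auto)[3])+) auto
  also have "ab (S \<inter> X) (T \<inter> X) = 0"
    using fin arc disj by (subst arcs_between_eq_0_iff) blast+
  also have "ab (S \<inter> Y) (T \<inter> Y) = 0"
    using fin arc disj by (subst arcs_between_eq_0_iff) blast+
  finally show ?thesis by simp
qed

lemma out_deg_X: "v \<in> X \<Longrightarrow> ab {v} V = ab {v} Y" and in_deg_X: "v \<in> X \<Longrightarrow> ab V {v} = ab Y {v}"
proof -
  assume v: "v \<in> X"
  have 0: "ab {v} X = 0" "ab X {v} = 0"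
    using v arc disj finX by (subst arcs_between_eq_0_iff; blast)+
  show "ab {v} V = ab {v} Y"
    by (subst arcs_between_Un_right) (use 0 disj finX finY in auto)
  show "ab V {v} = ab Y {v}"
    by (subst arcs_between_Un_left) (use 0 disj finX finY in auto)
qed

text \<open>Both semidegrees are at most \<open>a\<close> and their sum is at least
  \<open>a + k\<close>, so each is at least \<open>k\<close>.\<close>

lemma semidegree_bounds:
  assumes "v \<in> X"
  shows "ab {v} Y \<le> a" "ab Y {v} \<le> a" "d v = ab {v} Y + ab Y {v}" "k \<le> ab {v} Y" "k \<le> ab Y {v}"
proof -
  show 1: "ab {v} Y \<le> a" "ab Y {v} \<le> a"
    using arcs_between_le[of "{v}" Y E] arcs_between_le[of Y "{v}" E] finY cardY by auto
  show 2: "d v = ab {v} Y + ab Y {v}"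
    using out_deg_X in_deg_X assms by (simp add: deg_def)
  show "k \<le> ab {v} Y" "k \<le> ab Y {v}" using 1 2 deg_ge[of v] assms by auto
qed

text \<open>
  The set \<open>L\<close> of vertices of low degree loses at most \<open>(a - 2k) |L|\<close> in the degree sum, but sends at
  most \<open>m\<close> arcs to \<open>B\<close> instead of \<open>m |L|\<close>.
\<close>

lemma half_density:
  assumes "A \<subseteq> X" "B \<subseteq> Y" "int (card A) = m" "int (card B) = m" "a - 2 * k \<le> 2 * m"
  shows "m * (2 * a - k) - 2 * m * m - (a - 2 * k) \<le> (\<Sum>v\<in>A. d v) - 2 * ab A B"
    and "a = 2 * k + 1 \<Longrightarrow> 2 \<le> m \<Longrightarrow> u \<in> A \<Longrightarrow> v \<in> B \<Longrightarrow> \<not> E u v \<Longrightarrow>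
      m * (2 * a - k) - 2 * m * m + 1 \<le> (\<Sum>v\<in>A. d v) - 2 * ab A B"
proof -
  have fin: "finite A" "finite B" using assms finX finY finite_subset by auto
  define L where "L = {v \<in> A. d v < 2 * a - k}"
  define c where "c = int (card L)"
  have L: "L \<subseteq> A" "finite L" using fin by (auto simp: L_def)
  have cm: "c \<le> m" unfolding c_def using card_mono[OF fin(1) L(1)] assms(3) by simp
  have "(\<Sum>v\<in>A. 2 * a - k - (if v \<in> L then a - 2 * k else 0)) \<le> (\<Sum>v\<in>A. d v)"
    by (intro sum_mono) (use deg_ge assms(1) in \<open>fastforce simp: L_def\<close>)
  moreover have "(\<Sum>v\<in>A. if v \<in> L then a - 2 * k else 0) = c * (a - 2 * k)"
    using fin L by (simp add: sum.If_cases Int_absorb1 Collect_mem_eq c_def)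
  ultimately have low: "m * (2 * a - k) - c * (a - 2 * k) \<le> (\<Sum>v\<in>A. d v)"
    using assms(3) by (simp add: sum_subtractf)
  have eq: "ab A B = ab L B + ab (A - L) B"
    using arcs_between_Un_left[of L "A - L" E B] L fin by (simp add: Un_absorb1)
  \<comment> \<open>Two in-neighbours of \<open>v\<close> inside \<open>L\<close> would dominate
    \<open>v\<close> with both degrees low, contrary to \<open>dom\<close>.\<close>
  have "ab L {v} \<le> 1" if "v \<in> B" for v
  proof -
    have "card {u \<in> L. E u v} \<le> Suc 0"
      using L(2) dom by (subst card_le_Suc0_iff_eq) (simp, fastforce simp: L_def not_le)
    then show ?thesis using L(2) by (simp add: arcs_between_in)
  qed
  then have "(\<Sum>v\<in>B. ab L {v}) \<le> (\<Sum>v\<in>B. 1)" by (intro sum_mono)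
  then have small: "ab L B \<le> m" using assms(4) by (simp add: sum_arcs_between_right)
  have "int (card (A - L)) = m - c"
    using L fin assms(3) cm by (simp add: card_Diff_subset c_def of_nat_diff card_mono)
  then have big: "ab (A - L) B \<le> (m - c) * m"
    using arcs_between_le[of "A - L" B E] fin assms(4) by simp
  have up: "2 * ab A B \<le> 2 * m + 2 * m * m - 2 * c * m"
    using eq small big by (simp add: algebra_simps)
  have up0: "2 * ab A B \<le> 2 * m * m"
    using arcs_between_le[OF fin, of E] assms(3,4) by simp
  have c0: "0 \<le> c" by (simp add: c_def)
  show "m * (2 * a - k) - 2 * m * m - (a - 2 * k) \<le> (\<Sum>v\<in>A. d v) - 2 * ab A B"
  proof (cases "c = 0")
    case True
    then show ?thesis using low up0 ka by simp
  next
    case False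
    \<comment> \<open>This product is exactly the slack left when \<open>low\<close> and
      \<open>up\<close> are combined.\<close>
    then have "0 \<le> (c - 1) * (2 * m - (a - 2 * k))" using c0 assms(5) by (intro mult_nonneg_nonneg) auto
    then show ?thesis using low up by (simp add: algebra_simps)
  qed
  show "m * (2 * a - k) - 2 * m * m + 1 \<le> (\<Sum>v\<in>A. d v) - 2 * ab A B"
    if "a = 2 * k + 1" "2 \<le> m" "u \<in> A" "v \<in> B" "\<not> E u v"
  proof (cases "c \<le> 1")
    case True
    \<comment> \<open>A single low-degree vertex costs at most 1 here, while the absent arc gains
      2.\<close>
    have "2 * ab A B \<le> 2 * m * m - 2"
      using arcs_between_less[OF fin that(3,4), of E] that(5) assms(3,4) by simp
    then show ?thesis using low True that(1) by (simp add: algebra_simps)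
  next
    case False
    then have "0 \<le> (c - 1) * (m - 2)" using that(2) by simp
    then show ?thesis using low up False that(1) by (simp add: algebra_simps)
  qed
qed

section \<open>Degree sums over vertex sets\<close>

lemma sum_deg:
  assumes "S \<union> T = V" "S \<inter> T = {}"
  shows "(\<Sum>v\<in>S. d v) = 2 * ab S S + (ab S T + ab T S)"
proof -
  have fin: "finite S" "finite T" using assms finV by (metis finite_Un)+
  have "(\<Sum>v\<in>S. d v) = ab S V + ab V S"
    unfolding deg_def by (simp add: sum.distrib sum_arcs_between_left sum_arcs_between_right)
  also have "\<dots> = 2 * ab S S + (ab S T + ab T S)"
    using fin assms(2) unfolding assms(1)[symmetric]
    by (simp add: arcs_between_Un_left arcs_between_Un_right)
  finally show ?thesis .
qed

lemma sum_parts: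
  fixes g :: "'a \<Rightarrow> int"
  assumes "S \<subseteq> V"
  shows "(\<Sum>v\<in>S. g v) = (\<Sum>v\<in>S \<inter> X. g v) + (\<Sum>v\<in>S \<inter> Y. g v)"
proof -
  have "finite S" using assms finV finite_subset by auto
  then have "(\<Sum>v\<in>S \<inter> X \<union> S \<inter> Y. g v) = (\<Sum>v\<in>S \<inter> X. g v) + (\<Sum>v\<in>S \<inter> Y. g v)"
    using disj by (intro sum.union_disjoint) auto
  moreover have "S \<inter> X \<union> S \<inter> Y = S" using assms by blast
  ultimately show ?thesis by simp
qed

text \<open>The parts of \<open>S\<close> in \<open>X\<close> and in \<open>Y\<close> are estimated
  separately and added. When \<open>a = 2 * k + 1\<close>, an absent arc gains 1 in one part, which
  offsets the loss of at most \<open>a - 2 * k = 1\<close> in the other.\<close>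

lemma density:
  assumes "S \<subseteq> V" "int (card (S \<inter> X)) = m" "int (card (S \<inter> Y)) = m" "a - 2 * k \<le> 2 * m"
  shows "2 * m * (2 * a - k) - 4 * m * m - 2 * (a - 2 * k) \<le> (\<Sum>v\<in>S. d v) - 2 * ab S S"
    and "a = 2 * k + 1 \<Longrightarrow> 2 \<le> m \<Longrightarrow> u \<in> S \<Longrightarrow> v \<in> S \<Longrightarrow> (u \<in> X \<longleftrightarrow> v \<in> Y) \<Longrightarrow> \<not> E u v \<Longrightarrow>
      2 * m * (2 * a - k) - 4 * m * m \<le> (\<Sum>v\<in>S. d v) - 2 * ab S S"
proof -
  interpret sw: dominating_bipartite E Y X a k by (rule swap)
  have c: "Y \<union> X = V" by (rule Un_commute)
  note sp = ab_split[OF assms(1,1)] sum_parts[OF assms(1), of d]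
  note h1 = half_density[of "S \<inter> X" "S \<inter> Y" m, OF _ _ assms(2,3,4)]
  note h2 = sw.half_density[of "S \<inter> Y" "S \<inter> X" m, OF _ _ assms(3,2,4), unfolded c]
  show "2 * m * (2 * a - k) - 4 * m * m - 2 * (a - 2 * k) \<le> (\<Sum>v\<in>S. d v) - 2 * ab S S"
    using h1(1) h2(1) sp by (simp add: algebra_simps)
  show "2 * m * (2 * a - k) - 4 * m * m \<le> (\<Sum>v\<in>S. d v) - 2 * ab S S"
    if *: "a = 2 * k + 1" "2 \<le> m" "u \<in> S" "v \<in> S" "u \<in> X \<longleftrightarrow> v \<in> Y" "\<not> E u v"
  proof (cases "u \<in> X")
    case True
    then show ?thesis using h1(2)[of u v] h2(1) sp * by (simp add: algebra_simps)
  next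
    case False
    then have "u \<in> Y" "v \<in> X" using * assms(1) by auto
    then show ?thesis using h2(2)[of u v] h1(1) sp * by (simp add: algebra_simps)
  qed
qed

text \<open>Abstracts the vertex set of a union of disjoint cycles with successor map
  \<open>f\<close>, so that all remaining cycles of a factor can be treated together.\<close>

definition alternating :: "('a \<Rightarrow> 'a) \<Rightarrow> 'a set \<Rightarrow> bool" where
  "alternating f S \<longleftrightarrow> S \<subseteq> V \<and> f ` S = S \<and> (\<forall>v\<in>S. v \<in> X \<longleftrightarrow> f v \<in> Y)"

text \<open>A surjection of a finite set onto itself is injective, and \<open>f\<close> exchanges
  the two parts of \<open>S\<close>; hence \<open>S\<close> is balanced.\<close>

lemma alternating_image:
  assumes "alternating f S"
  shows "inj_on f S" "f ` (S \<inter> X) = S \<inter> Y" "f ` (S \<inter> Y) = S \<inter> X" "card (S \<inter> Y) = card (S \<inter> X)"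
proof -
  have S: "S \<subseteq> V" "f ` S = S" "\<And>v. v \<in> S \<Longrightarrow> v \<in> X \<longleftrightarrow> f v \<in> Y"
    using assms unfolding alternating_def by auto
  have "finite S" using S(1) finV finite_subset by auto
  then show inj: "inj_on f S" using S(2) by (intro eq_card_imp_inj_on) auto
  have fS: "f v \<in> S" if "v \<in> S" for v using that S(2) by blast
  have pre: "\<exists>u\<in>S. v = f u" if "v \<in> S" for v using that S(2) by blast
  have S4: "v \<in> Y \<longleftrightarrow> f v \<in> X" if "v \<in> S" for v
    using S(1) S(3)[OF that] that fS[OF that] disj by blast
  show *: "f ` (S \<inter> X) = S \<inter> Y"
  proof
    show "f ` (S \<inter> X) \<subseteq> S \<inter> Y" using fS S(3) by blast
    show "S \<inter> Y \<subseteq> f ` (S \<inter> X)" using pre S(3) by fast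
  qed
  show "f ` (S \<inter> Y) = S \<inter> X"
  proof
    show "f ` (S \<inter> Y) \<subseteq> S \<inter> X" using fS S4 by blast
    show "S \<inter> X \<subseteq> f ` (S \<inter> Y)" using pre S4 by fast
  qed
  have "card (f ` (S \<inter> X)) = card (S \<inter> X)" using inj by (intro card_image) (auto simp: inj_on_def)
  then show "card (S \<inter> Y) = card (S \<inter> X)" unfolding * .
qed

text \<open>By \<open>cyc_merge\<close>, a violating pair on two disjoint cycles of \<open>f\<close>
  would let these be merged.\<close>

definition unmergeable :: "('a \<Rightarrow> 'a) \<Rightarrow> 'a set \<Rightarrow> 'a set \<Rightarrow> bool" where
  "unmergeable f S T \<longleftrightarrow> (\<forall>u\<in>S. \<forall>w\<in>T. \<not> (E u (f w) \<and> E w (f u)))"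

text \<open>As \<open>f\<close> exchanges the parts, the pairs \<open>(u, w)\<close> from equal
  parts of \<open>S\<close> and \<open>T\<close> index both the arcs \<open>u -> f w\<close> and the
  arcs \<open>w -> f u\<close>; at most one of the two is present.\<close>

lemma unmergeable_arcs:
  assumes "alternating f S" "alternating f T" "unmergeable f S T"
  shows "ab (S \<inter> X) (T \<inter> Y) + ab (T \<inter> X) (S \<inter> Y) \<le> int (card (S \<inter> X)) * int (card (T \<inter> X))"
    and "ab (S \<inter> Y) (T \<inter> X) + ab (T \<inter> Y) (S \<inter> X) \<le> int (card (S \<inter> X)) * int (card (T \<inter> X))"
proof -
  have fin: "finite (S \<inter> X)" "finite (S \<inter> Y)" "finite (T \<inter> X)" "finite (T \<inter> Y)"
    using finX finY by auto
  note S = alternating_image[OF assms(1)] and T = alternating_image[OF assms(2)]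
  have inj: "inj_on f (S \<inter> X)" "inj_on f (S \<inter> Y)" "inj_on f (T \<inter> X)" "inj_on f (T \<inter> Y)"
    using S(1) T(1) by (auto intro: inj_on_subset)
  show "ab (S \<inter> X) (T \<inter> Y) + ab (T \<inter> X) (S \<inter> Y) \<le> int (card (S \<inter> X)) * int (card (T \<inter> X))"
    using arcs_between_no_swap[of "S \<inter> X" "T \<inter> X" f E] fin inj assms(3) S(2) T(2)
    by (auto simp: unmergeable_def)
  show "ab (S \<inter> Y) (T \<inter> X) + ab (T \<inter> Y) (S \<inter> X) \<le> int (card (S \<inter> X)) * int (card (T \<inter> X))"
    using arcs_between_no_swap[of "S \<inter> Y" "T \<inter> Y" f E] fin inj assms(3) S(3,4) T(3,4)
    by (auto simp: unmergeable_def)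
qed

lemma sum_deg_ge: "S \<subseteq> V \<Longrightarrow> int (card S) * (a + k) \<le> (\<Sum>v\<in>S. d v)"
  using sum_bounded_below[of S "a + k" d] deg_ge by auto

lemma card_parts:
  assumes "S \<subseteq> V"
  shows "card S = card (S \<inter> X) + card (S \<inter> Y)"
proof -
  have "card (S \<inter> X \<union> S \<inter> Y) = card (S \<inter> X) + card (S \<inter> Y)"
    using finX finY disj by (intro card_Un_disjoint) auto
  moreover have "S \<inter> X \<union> S \<inter> Y = S" using assms by blast
  ultimately show ?thesis by simp
qed

lemma inner_le:
  assumes "S \<subseteq> V" "int (card (S \<inter> X)) = m" "int (card (S \<inter> Y)) = m"
  shows "ab (S \<inter> X) (S \<inter> Y) \<le> m * m" "ab (S \<inter> Y) (S \<inter> X) \<le> m * m" "2 * ab S S \<le> 4 * m * m"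
proof -
  show "ab (S \<inter> X) (S \<inter> Y) \<le> m * m" "ab (S \<inter> Y) (S \<inter> X) \<le> m * m"
    using arcs_between_le[of "S \<inter> X" "S \<inter> Y" E] arcs_between_le[of "S \<inter> Y" "S \<inter> X" E] assms finX finY by auto
  then show "2 * ab S S \<le> 4 * m * m" using ab_split[OF assms(1,1)] by simp
qed

end

text \<open>
  In both counting arguments \<open>2m\<close> is the length of the shortest cycle, \<open>b = a - 2k\<close>, and \<open>j\<close> is the
  excess \<open>a - k - m\<close> or \<open>a - 1 - k - m\<close>.
\<close>

lemma excess_product:
  fixes m b k j :: int
  assumes "2 \<le> k" "k \<le> m" "b < 2 * k"
  shows "m + j = k + b \<Longrightarrow> b \<le> 2 * j \<Longrightarrow> m * j \<le> b \<Longrightarrow> b \<le> 0"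
    and "m + j = k + b - 1 \<Longrightarrow> b \<le> 2 * j + 1 \<Longrightarrow> m * j < b \<Longrightarrow> b \<le> 1"
proof -
  \<comment> \<open>For \<open>2 <= j\<close> this makes \<open>m * j\<close> exceed
    \<open>b\<close>, because \<open>b < 2 * k <= 2 * m\<close>.\<close>
  have two: "2 * m \<le> m * j" if "2 \<le> j"
    using that assms mult_left_mono[of 2 j m] by simp
  consider "j \<le> 0" | "j = 1" | "2 \<le> j" by linarith
  note cases = this
  show "b \<le> 0" if "m + j = k + b" "b \<le> 2 * j" "m * j \<le> b"
  proof (cases rule: cases)
    case 1
    then show ?thesis using that assms by linarith
  next
    case 2
    then show ?thesis using that assms by simp
  next
    case 3
    then show ?thesis using two that assms by linarith
  qed
  show "b \<le> 1" if "m + j = k + b - 1" "b \<le> 2 * j + 1" "m * j < b"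
  proof (cases rule: cases)
    case 1
    then show ?thesis using that assms by linarith
  next
    case 2
    then show ?thesis using that assms by simp
  next
    case 3
    then show ?thesis using two that assms by linarith
  qed
qed

context dominating_bipartite
begin

lemma cross_arcs:
  assumes "alternating f S" "alternating f T" "unmergeable f S T"
  shows "ab S T + ab T S \<le> 2 * (int (card (S \<inter> X)) * int (card (T \<inter> X)))"
proof -
  have "S \<subseteq> V" "T \<subseteq> V" using assms unfolding alternating_def by auto
  then show ?thesis
    using unmergeable_arcs[OF assms] ab_split[of S T] ab_split[of T S] by simp
qed

lemma pair_arcs:
  assumes "S \<subseteq> V" "int (card (S \<inter> X)) = m" "int (card (S \<inter> Y)) = m" "x \<in> X" "y \<in> Y"
    and "p \<in> S" "q \<in> {x, y}" "p \<in> X \<longleftrightarrow> q \<in> Y" "\<not> E p q \<or> \<not> E q p"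
  shows "ab S {x, y} + ab {x, y} S < 4 * m"
proof -
  have xy: "{x, y} \<inter> X = {x}" "{x, y} \<inter> Y = {y}" "{x, y} \<subseteq> V" using assms(4,5) disj by auto
  have fin: "finite (S \<inter> X)" "finite (S \<inter> Y)" using finX finY by auto
  have eq: "ab S {x, y} + ab {x, y} S
      = ab (S \<inter> X) {y} + ab (S \<inter> Y) {x} + ab {x} (S \<inter> Y) + ab {y} (S \<inter> X)"
    using ab_split[OF assms(1) xy(3)] ab_split[OF xy(3) assms(1)] xy by simp
  have le: "ab (S \<inter> X) {y} \<le> m" "ab (S \<inter> Y) {x} \<le> m" "ab {x} (S \<inter> Y) \<le> m" "ab {y} (S \<inter> X) \<le> m"
    using arcs_between_le[OF fin(1), of "{y}" E] arcs_between_le[OF fin(2), of "{x}" E]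
      arcs_between_le[OF _ fin(2), of "{x}" E] arcs_between_le[OF _ fin(1), of "{y}" E] assms(2,3)
    by simp_all
  have "x \<notin> Y" "y \<notin> X" "p \<in> V" using assms(1,4,5,6) disj by auto
  then have cases: "q = y \<and> p \<in> S \<inter> X \<or> q = x \<and> p \<in> S \<inter> Y"
    using assms(4-8) by auto
  have lt: "ab (S \<inter> X) {y} < m \<or> ab (S \<inter> Y) {x} < m \<or> ab {x} (S \<inter> Y) < m \<or> ab {y} (S \<inter> X) < m"
    using cases
  proof
    assume "q = y \<and> p \<in> S \<inter> X"
    then show ?thesis
      using assms(9) arcs_between_less[OF fin(1), of "{y}" p y E] assms(2)
        arcs_between_less[OF _ fin(1), of "{y}" y p E] by auto
  next
    assume "q = x \<and> p \<in> S \<inter> Y"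
    then show ?thesis
      using assms(9) arcs_between_less[OF fin(2), of "{x}" p x E] assms(3)
        arcs_between_less[OF _ fin(2), of "{x}" x p E] by auto
  qed
  then show ?thesis using eq le by linarith
qed

text \<open>Intended for two cycles covering all vertices but \<open>x\<close> and \<open>y\<close>.
  The degree sum over the smaller set \<open>S\<close> leaves only \<open>a = 2 * k + 1\<close> with
  \<open>m = k\<close>, and there the absent arc inside \<open>S\<close> sharpens
  \<open>density\<close> just enough for a contradiction.\<close>

lemma near_factor_mergeable:
  assumes part: "S \<union> T \<union> {x, y} = V" "S \<inter> T = {}" "x \<notin> S \<union> T" "y \<notin> S \<union> T" "x \<in> X" "y \<in> Y"
    and alt: "alternating f S" "alternating f T" and "S \<noteq> {}"
    and le: "card (S \<inter> X) \<le> card (T \<inter> X)"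
    and miss: "p \<in> S" "q \<in> {x, y}" "p \<in> X \<longleftrightarrow> q \<in> Y" "\<not> E p q \<or> \<not> E q p"
    and inner: "2 \<le> card (S \<inter> X) \<Longrightarrow> \<exists>p\<in>S. \<exists>q\<in>S. (p \<in> X \<longleftrightarrow> q \<in> Y) \<and> \<not> E p q"
  shows "\<not> unmergeable f S T"
proof
  assume um: "unmergeable f S T"
  define m where "m = int (card (S \<inter> X))"
  define m' where "m' = int (card (T \<inter> X))"
  have sub: "S \<subseteq> V" "T \<subseteq> V" using part by auto
  have fin: "finite S" "finite T" using sub finV finite_subset by auto
  have mY: "int (card (S \<inter> Y)) = m" using alternating_image(4)[OF alt(1)] m_def by simp
  have X: "X = insert x (S \<inter> X \<union> T \<inter> X)" using part disj by auto
  have "card X = Suc (card (S \<inter> X \<union> T \<inter> X))"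
    by (subst X, subst card_insert_disjoint) (use fin part in auto)
  also have "card (S \<inter> X \<union> T \<inter> X) = card (S \<inter> X) + card (T \<inter> X)"
    using fin part by (intro card_Un_disjoint) auto
  finally have am: "a = m + m' + 1" using cardX by (simp add: m_def m'_def)
  have mm': "m \<le> m'" using le by (simp add: m_def m'_def)
  have m1: "1 \<le> m"
  proof -
    have "card S = 2 * card (S \<inter> X)" using card_parts[OF sub(1)] alternating_image(4)[OF alt(1)] by simp
    moreover have "card S > 0" using \<open>S \<noteq> {}\<close> fin by (simp add: card_gt_0_iff)
    ultimately show ?thesis unfolding m_def by linarith
  qed
  have "(\<Sum>v\<in>S. d v) = 2 * ab S S + (ab S (T \<union> {x, y}) + ab (T \<union> {x, y}) S)"
    by (rule sum_deg) (use part in auto)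
  also have "ab S (T \<union> {x, y}) = ab S T + ab S {x, y}"
    by (rule arcs_between_Un_right) (use part fin in auto)
  also have "ab (T \<union> {x, y}) S = ab T S + ab {x, y} S"
    by (rule arcs_between_Un_left) (use part fin in auto)
  finally have up: "(\<Sum>v\<in>S. d v) - 2 * ab S S \<le> 2 * (m * m') + 4 * m - 1"
    using cross_arcs[OF alt um] pair_arcs[OF sub(1) m_def[symmetric] mY part(5,6) miss]
    by (simp add: m_def m'_def)
  \<comment> \<open>For smaller \<open>m\<close> the bound \<open>a + k\<close> on every degree
    already demands more arcs than there can be.\<close>
  have km: "k \<le> m"
  proof (rule ccontr)
    assume "\<not> k \<le> m"
    then have "0 \<le> m * (k - 1 - m)" using m1 by simp
    moreover have "2 * m * (a + k) \<le> (\<Sum>v\<in>S. d v)"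
      using sum_deg_ge[OF sub(1)] card_parts[OF sub(1)] mY m_def by simp
    moreover have "2 * ab S S \<le> 4 * m * m" by (rule inner_le(3)[OF sub(1) m_def[symmetric] mY])
    ultimately show False using up am by (simp add: algebra_simps)
  qed
  define b where "b = a - 2 * k"
  define j where "j = a - k - 1 - m"
  have b: "b < 2 * k" "0 \<le> b" using ak ka by (auto simp: b_def)
  have bm: "a - 2 * k \<le> 2 * m" using b km b_def by simp
  have "m * j < b"
    using density(1)[OF sub(1) m_def[symmetric] mY bm] up am by (simp add: b_def j_def algebra_simps)
  then have "b \<le> 1"
    by (intro excess_product(2)[OF k2 km b(1)]) (use am mm' in \<open>auto simp: b_def j_def\<close>)
  \<comment> \<open>If \<open>b = 0\<close>, then \<open>m + m' = 2 * k - 1\<close>, so the smaller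
    set would have \<open>m < k\<close>.\<close>
  then have "a = 2 * k + 1" "m = k" using b km am mm' by (auto simp: b_def)
  moreover obtain p q where "p \<in> S" "q \<in> S" "p \<in> X \<longleftrightarrow> q \<in> Y" "\<not> E p q"
    using inner \<open>m = k\<close> k2 by (auto simp: m_def)
  ultimately show False
    using density(2)[OF sub(1) m_def[symmetric] mY bm, of p q] up am k2 by (simp add: algebra_simps)
qed

text \<open>The same count without an exceptional pair: it forces \<open>b = 0\<close>, all
  estimates become equalities, and so no arc inside \<open>S\<close> or \<open>T\<close> is
  absent.\<close>

lemma extremal_factor:
  assumes part: "S \<union> T = V" "S \<inter> T = {}"
    and alt: "alternating f S" "alternating f T" and um: "unmergeable f S T" and "S \<noteq> {}"
    and le: "card (S \<inter> X) \<le> card (T \<inter> X)"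
  shows "a = 2 * k" "int (card (S \<inter> X)) = k" "int (card (T \<inter> X)) = k"
    "\<And>u v. u \<in> S \<Longrightarrow> v \<in> S \<Longrightarrow> (u \<in> X \<longleftrightarrow> v \<in> Y) \<Longrightarrow> E u v"
    "\<And>u v. u \<in> T \<Longrightarrow> v \<in> T \<Longrightarrow> (u \<in> X \<longleftrightarrow> v \<in> Y) \<Longrightarrow> E u v"
proof -
  define m where "m = int (card (S \<inter> X))"
  define m' where "m' = int (card (T \<inter> X))"
  have sub: "S \<subseteq> V" "T \<subseteq> V" using part by auto
  have fin: "finite S" "finite T" using sub finV finite_subset by auto
  have mY: "int (card (S \<inter> Y)) = m" using alternating_image(4)[OF alt(1)] m_def by simp
  have mY': "int (card (T \<inter> Y)) = m'" using alternating_image(4)[OF alt(2)] m'_def by simp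
  have X: "X = S \<inter> X \<union> T \<inter> X" using part disj by auto
  have "card X = card (S \<inter> X) + card (T \<inter> X)"
    by (subst X, rule card_Un_disjoint) (use fin part in auto)
  then have am: "a = m + m'" using cardX by (simp add: m_def m'_def)
  have mm': "m \<le> m'" using le by (simp add: m_def m'_def)
  have m1: "1 \<le> m"
  proof -
    have "card S = 2 * card (S \<inter> X)" using card_parts[OF sub(1)] alternating_image(4)[OF alt(1)] by simp
    moreover have "card S > 0" using \<open>S \<noteq> {}\<close> fin by (simp add: card_gt_0_iff)
    ultimately show ?thesis unfolding m_def by linarith
  qed
  have cross: "ab S T + ab T S \<le> 2 * (m * m')"
    using cross_arcs[OF alt um] by (simp add: m_def m'_def)
  have sumS: "(\<Sum>v\<in>S. d v) = 2 * ab S S + (ab S T + ab T S)" by (rule sum_deg[OF part])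
  have sumT: "(\<Sum>v\<in>T. d v) = 2 * ab T T + (ab T S + ab S T)"
    by (rule sum_deg) (use part in auto)
  have lowS: "2 * m * (a + k) \<le> (\<Sum>v\<in>S. d v)"
    using sum_deg_ge[OF sub(1)] card_parts[OF sub(1)] mY m_def by simp
  have lowT: "2 * m' * (a + k) \<le> (\<Sum>v\<in>T. d v)"
    using sum_deg_ge[OF sub(2)] card_parts[OF sub(2)] mY' m'_def by simp
  note inS = inner_le[OF sub(1) m_def[symmetric] mY]
  note inT = inner_le[OF sub(2) m'_def[symmetric] mY']
  have km: "k \<le> m"
  proof (rule ccontr)
    assume "\<not> k \<le> m"
    then have "0 < m * (k - m)" using m1 by simp
    then show False using sumS lowS cross inS(3) am by (simp add: algebra_simps)
  qed
  define b where "b = a - 2 * k"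
  define j where "j = a - k - m"
  have b: "b < 2 * k" "0 \<le> b" using ak ka by (auto simp: b_def)
  have bm: "a - 2 * k \<le> 2 * m" using b km b_def by simp
  have "m * j \<le> b"
    using density(1)[OF sub(1) m_def[symmetric] mY bm] sumS cross am by (simp add: b_def j_def algebra_simps)
  then have "b \<le> 0"
    by (intro excess_product(1)[OF k2 km b(1)]) (use am mm' in \<open>auto simp: b_def j_def\<close>)
  then show a: "a = 2 * k" using b by (simp add: b_def)
  show mk: "int (card (S \<inter> X)) = k" and mk': "int (card (T \<inter> X)) = k"
    using a km am mm' by (auto simp: m_def m'_def)
  have k: "m = k" "m' = k" using mk mk' by (auto simp: m_def m'_def)
  \<comment> \<open>The degree sum is at least \<open>6 * k * k\<close>, while inner and crossing
    arcs contribute at most \<open>4 * k * k\<close> and \<open>2 * k * k\<close>; both bounds are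
    attained.\<close>
  have fullS: "ab (S \<inter> X) (S \<inter> Y) = k * k" "ab (S \<inter> Y) (S \<inter> X) = k * k"
    using inS lowS sumS cross ab_split[OF sub(1,1)] a unfolding k by (simp_all add: algebra_simps)
  have fullT: "ab (T \<inter> X) (T \<inter> Y) = k * k" "ab (T \<inter> Y) (T \<inter> X) = k * k"
    using inT lowT sumT cross ab_split[OF sub(2,2)] a unfolding k by (simp_all add: algebra_simps)
  have full: "E u v" if "R \<subseteq> V" "finite R" "int (card (R \<inter> X)) = k" "int (card (R \<inter> Y)) = k"
      "ab (R \<inter> X) (R \<inter> Y) = k * k" "ab (R \<inter> Y) (R \<inter> X) = k * k" "u \<in> R" "v \<in> R" "u \<in> X \<longleftrightarrow> v \<in> Y"
    for R u v
  proof (rule ccontr)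
    assume "\<not> E u v"
    then show False
      using that arcs_between_less[of "R \<inter> X" "R \<inter> Y" u v E] arcs_between_less[of "R \<inter> Y" "R \<inter> X" u v E]
      by auto
  qed
  show "E u v" if "u \<in> S" "v \<in> S" "u \<in> X \<longleftrightarrow> v \<in> Y" for u v
    by (rule full[of S]) (use that sub fin mk mY fullS k in auto)
  show "E u v" if "u \<in> T" "v \<in> T" "u \<in> X \<longleftrightarrow> v \<in> Y" for u v
    by (rule full[of T]) (use that sub fin mk' mY' fullT k in auto)
qed

text \<open>All neighbours of \<open>v\<close> would lie among the \<open>k\<close> vertices of
  \<open>S \<inter> Y\<close>, giving degree at most \<open>2 * k < a + k\<close>.\<close>

lemma isolated_half_deg:
  assumes "S \<union> T = V" "S \<inter> T = {}" "int (card (S \<inter> Y)) = k" "a = 2 * k" "v \<in> S \<inter> X"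
    and "\<And>w. w \<in> T \<inter> Y \<Longrightarrow> \<not> E v w \<and> \<not> E w v"
  shows False
proof -
  have fin: "finite (S \<inter> Y)" "finite (T \<inter> Y)" using finY by auto
  have Y: "Y = S \<inter> Y \<union> T \<inter> Y" using assms(1) by blast
  have "ab {v} (T \<inter> Y) = 0" "ab (T \<inter> Y) {v} = 0"
    using assms(6) fin by (subst arcs_between_eq_0_iff; simp)+
  moreover have "ab {v} Y = ab {v} (S \<inter> Y) + ab {v} (T \<inter> Y)"
    by (subst Y, rule arcs_between_Un_right) (use fin assms(2) in auto)
  moreover have "ab Y {v} = ab (S \<inter> Y) {v} + ab (T \<inter> Y) {v}"
    by (subst Y, rule arcs_between_Un_left) (use fin assms(2) in auto)
  moreover have "ab {v} (S \<inter> Y) \<le> k" "ab (S \<inter> Y) {v} \<le> k"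
    using arcs_between_le[of "{v}" "S \<inter> Y" E] arcs_between_le[of "S \<inter> Y" "{v}" E] fin assms(3) by auto
  ultimately have "d v \<le> 2 * k" using semidegree_bounds(3)[of v] assms(5) by simp
  then show False using deg_ge[of v] assms(4,5) k2 by simp
qed

end

section \<open>Hamiltonian cycles\<close>

context dominating_bipartite
begin

text \<open>Suppose \<open>S\<close> violates Hall's condition. Two of its vertices share an
  out-neighbour, so some \<open>z\<close> in \<open>S\<close> has out-degree at least
  \<open>a - k\<close>, whence \<open>S\<close> has more than \<open>a - k\<close> elements. A
  vertex \<open>y\<close> that \<open>S\<close> does not reach then has fewer than \<open>k\<close>
  in-neighbours.\<close>

lemma ex_matching: "\<exists>f. inj_on f X \<and> (\<forall>u\<in>X. f u \<in> Y \<and> E u (f u))"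
proof -
  interpret sw: dominating_bipartite E Y X a k by (rule swap)
  let ?N = "\<lambda>u. {w \<in> Y. E u w}"
  have N: "int (card (?N u)) = ab {u} Y" for u using finY by (simp add: arcs_between_out)
  have "\<exists>f. inj_on f X \<and> (\<forall>u\<in>X. f u \<in> ?N u)"
  proof (rule hall_marriage[OF finX])
    show "finite (?N u)" for u using finY by simp
    show "card S \<le> card (\<Union>u\<in>S. ?N u)" if S: "S \<subseteq> X" for S
    proof (rule ccontr)
      assume less: "\<not> card S \<le> card (\<Union>u\<in>S. ?N u)"
      have finS: "finite S" using S finX finite_subset by auto
      have "\<exists>u\<in>S. \<exists>v\<in>S. u \<noteq> v \<and> ?N u \<inter> ?N v \<noteq> {}"
      proof (rule ccontr)
        assume "\<not> ?thesis"
        then have "card (\<Union>u\<in>S. ?N u) = (\<Sum>u\<in>S. card (?N u))"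
          using finS finY by (intro card_UN_disjoint) auto
        moreover have "(\<Sum>u\<in>S. 1) \<le> (\<Sum>u\<in>S. card (?N u))"
        proof (rule sum_mono)
          fix u assume "u \<in> S"
          then have "k \<le> ab {u} Y" using S semidegree_bounds(4) by auto
          then show "1 \<le> card (?N u)" using N[of u] k2 by linarith
        qed
        ultimately show False using less by simp
      qed
      then obtain u v w where "u \<in> S" "v \<in> S" "u \<noteq> v" "E u w" "E v w" by blast
      then obtain z where z: "z \<in> S" "2 * a - k \<le> d z" using dom by blast
      then have zX: "z \<in> X" using S by auto
      have "a - k \<le> ab {z} Y" using semidegree_bounds(2,3)[OF zX] z(2) by linarith
      moreover have "card (?N z) \<le> card (\<Union>u\<in>S. ?N u)"
        by (rule card_mono) (use finS finY z in auto)
      ultimately have cS: "a - k < int (card S)" using N[of z] less by linarith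
      have "card S \<le> card X" using S finX by (rule card_mono[rotated])
      then have "card (\<Union>u\<in>S. ?N u) < card Y" using less cardX cardY by linarith
      then have "(\<Union>u\<in>S. ?N u) \<noteq> Y" by auto
      then obtain y where y: "y \<in> Y" "\<And>u. u \<in> S \<Longrightarrow> \<not> E u y" by blast
      have "ab X {y} = int (card {u \<in> X. E u y})" using finX by (rule arcs_between_in)
      also have "card {u \<in> X. E u y} \<le> card (X - S)"
        by (rule card_mono) (use y finX in auto)
      also have "int (card (X - S)) = a - int (card S)"
        using S finS cardX finX by (simp add: card_Diff_subset card_mono of_nat_diff)
      finally show False using sw.semidegree_bounds(5)[OF y(1)] cS by simp
    qed
  qed
  then show ?thesis by auto
qed

text \<open>A matching from \<open>X\<close> to \<open>Y\<close> and one from \<open>Y\<close> to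
  \<open>X\<close> together form a permutation along arcs.\<close>

lemma ex_factor: "\<exists>F. cycle_factor E V F"
proof -
  interpret sw: dominating_bipartite E Y X a k by (rule swap)
  obtain f where f: "inj_on f X" "\<And>u. u \<in> X \<Longrightarrow> f u \<in> Y \<and> E u (f u)" using ex_matching by blast
  obtain g where g: "inj_on g Y" "\<And>u. u \<in> Y \<Longrightarrow> g u \<in> X \<and> E u (g u)" using sw.ex_matching by blast
  let ?h = "\<lambda>v. if v \<in> X then f v else g v"
  have inj: "inj_on ?h V"
  proof (rule inj_onI)
    fix u v assume uv: "u \<in> V" "v \<in> V" "?h u = ?h v"
    have "u \<in> X \<longleftrightarrow> v \<in> X"
    proof (rule ccontr)
      assume "\<not> ?thesis"
      then consider "u \<in> X" "v \<notin> X" "v \<in> Y" | "u \<notin> X" "u \<in> Y" "v \<in> X" using uv by blast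
      then show False using f(2) g(2) uv(3) disj by cases (simp, metis disjoint_iff)+
    qed
    then show "u = v" using uv f(1) g(1) by (auto dest: inj_onD split: if_splits)
  qed
  have "?h ` V \<subseteq> V" using f(2) g(2) by auto
  then have "?h ` V = V" using inj finV by (intro endo_inj_surj) auto
  then have bij: "bij_betw ?h V V" using inj by (simp add: bij_betw_def)
  show ?thesis by (rule ex_cycle_factor[OF finV bij]) (use f(2) g(2) in auto)
qed

section \<open>Cycles in a bipartite digraph, and joining two complete halves\<close>

lemma cyc_alternating:
  assumes "cyc E xs" "map f xs = rotate1 xs"
  shows "alternating f (set xs)"
proof -
  have "E v (f v)" if "v \<in> set xs" for v using cyc_succ[OF assms that] .
  moreover have "f ` set xs = set xs" using succ_bij[OF assms(2)] by (simp add: bij_betw_def)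
  ultimately show ?thesis unfolding alternating_def using arc disj by blast
qed

lemma card_cyc:
  assumes "cyc E xs"
  shows "set xs \<subseteq> V" "length xs = 2 * card (set xs \<inter> X)" "card (set xs \<inter> Y) = card (set xs \<inter> X)"
proof -
  obtain f where f: "map f xs = rotate1 xs"
    using ex_succ[of "{xs}"] assms by (auto simp: cyc_def)
  note alt = cyc_alternating[OF assms f]
  show sub: "set xs \<subseteq> V" using alt by (simp add: alternating_def)
  show *: "card (set xs \<inter> Y) = card (set xs \<inter> X)" using alternating_image(4)[OF alt] .
  show "length xs = 2 * card (set xs \<inter> X)"
    using card_parts[OF sub] * distinct_card[of xs] assms by (simp add: cyc_def)
qed

text \<open>Where all arcs between the parts are present, transposing two vertices of the same part
  preserves arcs. Transposing \<open>f u\<close> and \<open>z\<close> makes \<open>z\<close> the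
  successor of \<open>u\<close>.\<close>

lemma cyc_relabel:
  assumes "cyc E xs" "u \<in> set xs" "z \<in> set xs" "u \<in> X \<longleftrightarrow> z \<in> Y"
    and full: "\<And>p q. p \<in> set xs \<Longrightarrow> q \<in> set xs \<Longrightarrow> (p \<in> X \<longleftrightarrow> q \<in> Y) \<Longrightarrow> E p q"
  obtains us where "cyc E (us @ [u])" "set (us @ [u]) = set xs" "hd (us @ [u]) = z"
proof -
  obtain f where f: "map f xs = rotate1 xs"
    using ex_succ[of "{xs}"] assms(1) by (auto simp: cyc_def)
  obtain us where us: "cyc E (us @ [u])" "set (us @ [u]) = set xs" "hd (us @ [u]) = f u"
    using cyc_ending_at[OF assms(1) f assms(2)] by metis
  have sub: "set xs \<subseteq> V" using card_cyc(1)[OF assms(1)] .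
  have arcu: "E u (f u)" using cyc_succ[OF assms(1) f assms(2)] .
  have fu: "f u \<in> set xs" using us(2,3) by (metis hd_in_set snoc_eq_iff_butlast)
  have parity: "f u \<in> X \<longleftrightarrow> z \<in> X" "f u \<in> Y \<longleftrightarrow> z \<in> Y" "u \<noteq> f u" "u \<noteq> z"
  proof -
    have "u \<in> V" "z \<in> V" using assms(2,3) sub by auto
    then have "u \<in> X \<and> u \<notin> Y \<and> f u \<in> Y \<and> f u \<notin> X \<and> z \<in> Y \<and> z \<notin> X \<or>
        u \<in> Y \<and> u \<notin> X \<and> f u \<in> X \<and> f u \<notin> Y \<and> z \<in> X \<and> z \<notin> Y"
      using arc[OF arcu] assms(4) disj by blast
    then show "f u \<in> X \<longleftrightarrow> z \<in> X" "f u \<in> Y \<longleftrightarrow> z \<in> Y" "u \<noteq> f u" "u \<noteq> z" by auto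
  qed
  let ?s = "transpose (f u) z"
  have su: "?s u = u" using parity by simp
  have sset: "?s ` set xs = set xs" using fu assms(3) by (simp add: transpose_image_eq)
  have spart: "?s p \<in> X \<longleftrightarrow> p \<in> X" "?s p \<in> Y \<longleftrightarrow> p \<in> Y" for p
    using parity(1,2) by (auto simp: transpose_def)
  have sarc: "E (?s p) (?s q)" if "p \<in> set xs" "q \<in> set xs" "E p q" for p q
  proof (rule full)
    show "?s p \<in> set xs" "?s q \<in> set xs" using that sset by blast+
    show "?s p \<in> X \<longleftrightarrow> ?s q \<in> Y" unfolding spart using arc[OF that(3)] disj by blast
  qed
  define L where "L = us @ [u]"
  have L: "L \<noteq> []" "last L = u" "distinct L" "successively E L" "set L = set xs" "hd L = f u"
    using us by (simp_all add: L_def cyc_def)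
  have hdL: "hd (map ?s L) = z" using L(1,6) by (simp add: hd_map)
  have "cyc E (map ?s L)"
    unfolding cyc_def
  proof (intro conjI)
    show "distinct (map ?s L)"
      using L(3) by (simp add: distinct_map inj_on_inverseI[where g = ?s])
    show "successively E (map ?s L)"
      unfolding successively_map using L(4) by (rule successively_mono) (use L(5) sarc in auto)
    have "hd (map ?s L) = ?s (f u)" "last (map ?s L) = u"
      using hdL L(1,2) su by (simp_all add: last_map)
    then show "E (last (map ?s L)) (hd (map ?s L))"
      using sarc[OF assms(2) fu arcu] su by simp
  qed (use L in simp)
  moreover have "map ?s L = map ?s us @ [u]" using su by (simp add: L_def)
  moreover have "set (map ?s L) = set xs" using L(5) sset by (metis set_map)
  ultimately show thesis using that hdL by metis
qed

lemma cyc_join: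
  assumes "cyc E (us @ [u])" "cyc E (ws @ [w])" "set (us @ [u]) \<inter> set (ws @ [w]) = {}"
    and "E u (hd (ws @ [w]))" "E w (hd (us @ [u]))"
  shows "cyc E ((us @ [u]) @ (ws @ [w]))"
  using assms unfolding cyc_def
  by (subst successively_append_iff) (auto simp: hd_append split: if_splits)

text \<open>The cycles are first relabelled so that \<open>u\<close> precedes \<open>z\<close> and
  \<open>w\<close> precedes \<open>v\<close>; the two given arcs then join them.\<close>

lemma extremal_pair_join:
  assumes xs: "cyc E xs" and ys: "cyc E ys" and dis: "set xs \<inter> set ys = {}" and un: "set xs \<union> set ys = V"
    and fullx: "\<And>p q. p \<in> set xs \<Longrightarrow> q \<in> set xs \<Longrightarrow> (p \<in> X \<longleftrightarrow> q \<in> Y) \<Longrightarrow> E p q"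
    and fully: "\<And>p q. p \<in> set ys \<Longrightarrow> q \<in> set ys \<Longrightarrow> (p \<in> X \<longleftrightarrow> q \<in> Y) \<Longrightarrow> E p q"
    and uv: "u \<in> set xs \<inter> X" "v \<in> set ys \<inter> Y" "E u v" and wz: "w \<in> set ys \<inter> X" "z \<in> set xs \<inter> Y" "E w z"
  shows "\<exists>zs. cyc E zs \<and> set zs = V"
proof -
  obtain us where us: "cyc E (us @ [u])" "set (us @ [u]) = set xs" "hd (us @ [u]) = z"
    using cyc_relabel[OF xs, of u z] fullx uv(1) wz(2) by blast
  obtain ws where ws: "cyc E (ws @ [w])" "set (ws @ [w]) = set ys" "hd (ws @ [w]) = v"
    using cyc_relabel[OF ys, of w v] fully uv(2) wz(1) by blast
  have "cyc E ((us @ [u]) @ (ws @ [w]))"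
    by (rule cyc_join) (use us ws dis uv wz in auto)
  moreover have "set ((us @ [u]) @ (ws @ [w])) = V" using us(2) ws(2) un by (metis set_append)
  ultimately show ?thesis by blast
qed

text \<open>Without a Hamiltonian cycle, the arcs from \<open>X\<close> to \<open>Y\<close> cross
  between the halves in at most one direction, and likewise those from \<open>Y\<close> to
  \<open>X\<close>. If both leave the same half, the other cannot be left, against strong
  connectivity; otherwise one part of the first half has no neighbours in the second, against
  \<open>isolated_half_deg\<close>.\<close>

lemma extremal_pair:
  assumes xs: "cyc E xs" and ys: "cyc E ys" and dis: "set xs \<inter> set ys = {}" and un: "set xs \<union> set ys = V"
    and card: "a = 2 * k" "int (card (set xs \<inter> X)) = k" "int (card (set ys \<inter> X)) = k"
    and fullx: "\<And>p q. p \<in> set xs \<Longrightarrow> q \<in> set xs \<Longrightarrow> (p \<in> X \<longleftrightarrow> q \<in> Y) \<Longrightarrow> E p q"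
    and fully: "\<And>p q. p \<in> set ys \<Longrightarrow> q \<in> set ys \<Longrightarrow> (p \<in> X \<longleftrightarrow> q \<in> Y) \<Longrightarrow> E p q"
  shows "\<exists>zs. cyc E zs \<and> set zs = V"
proof (rule ccontr)
  assume no: "\<not> ?thesis"
  interpret sw: dominating_bipartite E Y X a k by (rule swap)
  let ?S = "set xs" and ?T = "set ys"
  have c: "Y \<union> X = V" by (rule Un_commute)
  have un': "?S \<union> ?T = Y \<union> X" using un by blast
  have fullx': "E p q" if "p \<in> ?S" "q \<in> ?S" "p \<in> Y \<longleftrightarrow> q \<in> X" for p q
    by (rule fullx) (use that un disj in blast)+
  have fully': "E p q" if "p \<in> ?T" "q \<in> ?T" "p \<in> Y \<longleftrightarrow> q \<in> X" for p q
    by (rule fully) (use that un disj in blast)+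
  have exX: "\<not> E u v \<or> \<not> E w z" if "u \<in> ?S \<inter> X" "v \<in> ?T \<inter> Y" "w \<in> ?T \<inter> X" "z \<in> ?S \<inter> Y" for u v w z
    using extremal_pair_join[OF xs ys dis un fullx fully that(1,2) _ that(3,4)] no by blast
  have exY: "\<not> E u v \<or> \<not> E w z" if "u \<in> ?S \<inter> Y" "v \<in> ?T \<inter> X" "w \<in> ?T \<inter> Y" "z \<in> ?S \<inter> X" for u v w z
    using sw.extremal_pair_join[OF xs ys dis un' fullx' fully' that(1,2) _ that(3,4)] no unfolding c by blast
  have cardY: "int (card (?S \<inter> Y)) = k" "int (card (?T \<inter> Y)) = k"
    using card card_cyc(3)[OF xs] card_cyc(3)[OF ys] by auto
  have ne: "?S \<inter> X \<noteq> {}" "?S \<inter> Y \<noteq> {}" "?T \<noteq> {}" using card cardY k2 by auto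
  have "?S \<subseteq> V" "?T \<subseteq> V" "?S \<noteq> {}" "V - ?S = ?T" "V - ?T = ?S"
    using un dis ne by auto
  moreover from this have "?S \<noteq> V" "?T \<noteq> V" using ne(3) by (metis Diff_cancel)+
  ultimately have sub: "?S \<subseteq> V" "?T \<subseteq> V" "?S \<noteq> {}" "V - ?S = ?T" "V - ?T = ?S" "?S \<noteq> V" "?T \<noteq> V"
    by blast+
  have leaveS: "\<exists>u\<in>?S. \<exists>v\<in>?T. E u v" using strong[of ?S] sub by simp
  have leaveT: "\<exists>u\<in>?T. \<exists>v\<in>?S. E u v" using strong[of ?T] sub ne(3) by simp
  have noS: "(\<forall>u\<in>?S \<inter> X. \<forall>v\<in>?T \<inter> Y. \<not> E u v) \<or> (\<forall>w\<in>?T \<inter> X. \<forall>z\<in>?S \<inter> Y. \<not> E w z)"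
    using exX by blast
  have noT: "(\<forall>u\<in>?S \<inter> Y. \<forall>v\<in>?T \<inter> X. \<not> E u v) \<or> (\<forall>w\<in>?T \<inter> Y. \<forall>z\<in>?S \<inter> X. \<not> E w z)"
    using exY by blast
  obtain x where x: "x \<in> ?S \<inter> X" using ne by blast
  obtain y where y: "y \<in> ?S \<inter> Y" using ne by blast
  from noS noT show False
  proof (elim disjE)
    assume "\<forall>u\<in>?S \<inter> X. \<forall>v\<in>?T \<inter> Y. \<not> E u v" "\<forall>u\<in>?S \<inter> Y. \<forall>v\<in>?T \<inter> X. \<not> E u v"
    then show False using leaveS arc by blast
  next
    assume "\<forall>w\<in>?T \<inter> X. \<forall>z\<in>?S \<inter> Y. \<not> E w z" "\<forall>w\<in>?T \<inter> Y. \<forall>z\<in>?S \<inter> X. \<not> E w z"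
    then show False using leaveT arc by blast
  next
    assume "\<forall>u\<in>?S \<inter> X. \<forall>v\<in>?T \<inter> Y. \<not> E u v" "\<forall>w\<in>?T \<inter> Y. \<forall>z\<in>?S \<inter> X. \<not> E w z"
    then show False using isolated_half_deg[OF un dis cardY(1) card(1) x] x by blast
  next
    assume "\<forall>w\<in>?T \<inter> X. \<forall>z\<in>?S \<inter> Y. \<not> E w z" "\<forall>u\<in>?S \<inter> Y. \<forall>v\<in>?T \<inter> X. \<not> E u v"
    then show False using sw.isolated_half_deg[OF un' dis card(2,1) y] y by blast
  qed
qed

text \<open>In a factor with fewest cycles, a cycle no longer than some other one is compared with
  the union of all the rest. Only the extremal case of \<open>extremal_factor\<close>
  remains.\<close>

lemma hamiltonian: "\<exists>xs. cyc E xs \<and> set xs = V"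
proof (rule ccontr)
  assume no: "\<not> ?thesis"
  obtain F where F: "cycle_factor E V F" and min: "\<And>G. cycle_factor E V G \<Longrightarrow> card F \<le> card G"
    using ex_has_least_nat[of "cycle_factor E V" _ card] ex_factor by blast
  have finF: "finite F" and dis: "\<And>xs ys. xs \<in> F \<Longrightarrow> ys \<in> F \<Longrightarrow> xs \<noteq> ys \<Longrightarrow> set xs \<inter> set ys = {}"
    and un: "\<Union> (set ` F) = V" and cycF: "\<And>xs. xs \<in> F \<Longrightarrow> cyc E xs"
    using F by (auto simp: cycle_factor_def pairwise_def)
  obtain f where f: "\<And>xs. xs \<in> F \<Longrightarrow> map f xs = rotate1 xs"
    using ex_succ[of F] F by (auto simp: cycle_factor_def cyc_def)
  have alt: "alternating f (set xs)" if "xs \<in> F" for xs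
    using cyc_alternating cycF f that by blast
  have "V \<noteq> {}" using cardX ka k2 by auto
  then obtain xs0 where xs0: "xs0 \<in> F" using un by blast
  then have "set xs0 \<noteq> V" using no cycF by blast
  then obtain ys0 where ys0: "ys0 \<in> F" "ys0 \<noteq> xs0" using un xs0 by blast
  have "\<exists>xs\<in>F. \<exists>ys\<in>F. xs \<noteq> ys \<and> card (set xs \<inter> X) \<le> card (set ys \<inter> X)"
    using xs0 ys0 by (metis nat_le_linear)
  then obtain xs ys where xs: "xs \<in> F" and ys: "ys \<in> F" and neq: "xs \<noteq> ys"
    and le: "card (set xs \<inter> X) \<le> card (set ys \<inter> X)" by blast
  define S where "S = set xs"
  define T where "T = \<Union> (set ` (F - {xs}))"
  have ST: "S \<union> T = V" "S \<inter> T = {}" using un xs dis by (auto simp: S_def T_def)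
  have yT: "set ys \<subseteq> T" using ys neq by (auto simp: T_def)
  have altS: "alternating f S" using alt xs by (simp add: S_def)
  have altT: "alternating f T"
    using alt unfolding alternating_def T_def by (auto simp: image_UN)
  have um: "unmergeable f S T"
    unfolding unmergeable_def
  proof (intro ballI notI)
    fix u w assume u: "u \<in> S" and "w \<in> T" and E: "E u (f w) \<and> E w (f u)"
    then obtain ws where ws: "ws \<in> F" "ws \<noteq> xs" "w \<in> set ws" by (auto simp: T_def)
    obtain zs where zs: "cyc E zs" "set zs = set xs \<union> set ws"
      using cyc_merge[OF cycF[OF xs] f[OF xs] cycF[OF ws(1)] f[OF ws(1)], of u w]
        dis[OF xs ws(1)] ws u E by (auto simp: S_def)
    let ?G = "insert zs (F - {xs, ws})"
    have "set zs \<inter> set vs = {}" if "vs \<in> F - {xs, ws}" for vs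
      using zs(2) dis[of xs vs] dis[of ws vs] xs ws(1) that by auto
    moreover have "\<Union> (set ` ?G) = V" using zs(2) un xs ws(1) by auto
    ultimately have "cycle_factor E V ?G"
      using finF dis cycF zs(1) unfolding cycle_factor_def pairwise_insert pairwise_def
      by (auto simp: Int_commute)
    then have "card F \<le> card ?G" by (rule min)
    also have "card ?G \<le> Suc (card (F - {xs, ws}))" by (simp add: card_insert_le_m1 finF card_insert_if)
    also have "card (F - {xs, ws}) = card F - 2"
      using xs ws finF by (subst card_Diff_subset) auto
    finally have "card F \<le> Suc (card F - 2)" .
    moreover have "card {xs, ws} \<le> card F" using xs ws finF by (intro card_mono) auto
    ultimately show False using ws(2) by simp
  qed
  have "S \<noteq> {}" using cycF[OF xs] by (simp add: S_def cyc_def)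
  moreover have leT: "card (set ys \<inter> X) \<le> card (T \<inter> X)" using yT finX by (intro card_mono) auto
  ultimately have ext: "a = 2 * k" "int (card (S \<inter> X)) = k" "int (card (T \<inter> X)) = k"
    "\<And>u v. u \<in> S \<Longrightarrow> v \<in> S \<Longrightarrow> (u \<in> X \<longleftrightarrow> v \<in> Y) \<Longrightarrow> E u v"
    "\<And>u v. u \<in> T \<Longrightarrow> v \<in> T \<Longrightarrow> (u \<in> X \<longleftrightarrow> v \<in> Y) \<Longrightarrow> E u v"
    using extremal_factor[OF ST altS altT um] le by (auto simp: S_def)
  \<comment> \<open>The cycle \<open>ys\<close> has at least \<open>k\<close> vertices in
    \<open>X\<close>, as many as all of \<open>T\<close>, so the factor consists of
    \<open>xs\<close> and \<open>ys\<close> only.\<close>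
  have "card (set ys \<inter> X) = card (T \<inter> X)" using ext(2,3) le leT by (simp add: S_def)
  then have "card (set ys) = card T"
    using card_parts[of "set ys"] card_parts[of T] card_cyc[OF cycF[OF ys]]
      alternating_image(4)[OF altT] altT by (simp add: alternating_def)
  moreover have "finite T" using ST finV by (metis finite_Un)
  ultimately have T: "T = set ys" using yT by (metis card_subset_eq)
  show False
    using no extremal_pair[OF cycF[OF xs] cycF[OF ys]] ST ext unfolding S_def T by blast
qed

section \<open>Shorter cycles\<close>

text \<open>Averaging: as \<open>h\<close> permutes \<open>V\<close>, the sum over all
  \<open>u\<close> is the total degree sum, which exceeds \<open>a\<close> times the number of
  vertices.\<close>

lemma ex_rich_chord:
  assumes "bij_betw h V V"
  shows "\<exists>u\<in>V. a < ab {u} V + ab V {h u}"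
proof (rule ccontr)
  assume "\<not> ?thesis"
  then have "ab {u} V + ab V {h u} \<le> a" if "u \<in> V" for u using that by (meson not_le)
  then have "(\<Sum>u\<in>V. ab {u} V + ab V {h u}) \<le> (\<Sum>u\<in>V. a)" by (rule sum_mono)
  moreover have "(\<Sum>u\<in>V. ab V {h u}) = (\<Sum>u\<in>V. ab V {u})"
    using assms by (rule sum.reindex_bij_betw)
  moreover have "(\<Sum>v\<in>V. d v) = (\<Sum>u\<in>V. ab {u} V) + (\<Sum>u\<in>V. ab V {u})"
    by (simp add: deg_def sum.distrib)
  ultimately have "int (card V) * (a + k) \<le> int (card V) * a"
    using sum_deg_ge[of V] by (simp add: sum.distrib)
  moreover have "0 < card V" using cardX ka k2 finV by (auto simp: card_gt_0_iff)
  ultimately show False using k2 by (simp add: mult_le_cancel_left)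
qed

text \<open>Pigeonhole among the \<open>a - 2\<close> vertices of \<open>X - {x, u}\<close>:
  in-neighbours of \<open>p\<close> against predecessors of out-neighbours of \<open>u\<close>. Each
  count loses at most one arc, \<open>x -> p\<close> and \<open>u -> y\<close> respectively, so
  together they exceed \<open>a - 2\<close>.\<close>

lemma splitting_vertex:
  assumes f: "bij_betw f V V" "\<And>v. v \<in> V \<Longrightarrow> E v (f v)"
    and u: "u \<in> X" "f u = y" "f y = x" "f x = p" "x \<noteq> u" "\<not> E u p"
    and rich: "a < ab {u} V + ab V {p}"
  shows "\<exists>w\<in>X - {x, u}. E w p \<and> E u (f w)"
proof (rule ccontr)
  interpret sw: dominating_bipartite E Y X a k by (rule swap)
  assume no: "\<not> ?thesis"
  have y: "y \<in> Y" using arc[OF f(2)[of u]] u disj by auto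
  have x: "x \<in> X" using arc[OF f(2)[of y]] y u disj by auto
  have p: "p \<in> Y" using arc[OF f(2)[of x]] x u disj by auto
  define A where "A = {w \<in> X - {x, u}. E w p}"
  define B where "B = {w \<in> X - {x, u}. E u (f w)}"
  have fin: "finite A" "finite B" using finX by (auto simp: A_def B_def)
  have "card A + card B = card (A \<union> B)"
    using no fin by (intro card_Un_disjoint[symmetric]) (auto simp: A_def B_def)
  also have "\<dots> \<le> card (X - {x, u})" using finX by (intro card_mono) (auto simp: A_def B_def)
  also have "\<dots> = card X - 2" using x u finX by (subst card_Diff_subset) auto
  finally have AB: "int (card A) + int (card B) \<le> a - 2" using cardX k2 ka by linarith
  have "ab V {p} = int (card {w \<in> X. E w p})"
    using sw.in_deg_X[OF p] finX by (simp add: arcs_between_in Un_commute)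
  also have "card {w \<in> X. E w p} \<le> card (insert x A)"
    using fin u by (intro card_mono) (auto simp: A_def)
  also have "\<dots> \<le> Suc (card A)" using fin by (simp add: card_insert_if)
  finally have 1: "ab V {p} \<le> int (card A) + 1" by simp
  have "{v \<in> Y. E u v} \<subseteq> insert y (f ` B)"
  proof
    fix v assume v: "v \<in> {v \<in> Y. E u v}"
    then have "v \<in> f ` V" using f(1) by (simp add: bij_betw_imp_surj_on)
    then obtain w where w: "f w = v" "w \<in> V" by (elim imageE) simp
    then have "w \<in> X" using arc[OF f(2)[OF w(2)]] v disj by auto
    then show "v \<in> insert y (f ` B)" using u w v by (auto simp: B_def)
  qed
  then have "card {v \<in> Y. E u v} \<le> card (insert y (f ` B))" using fin by (intro card_mono) auto
  also have "\<dots> \<le> Suc (card B)" using fin card_image_le[of B f] by (simp add: card_insert_if)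
  finally have 2: "ab {u} V \<le> int (card B) + 1"
    using out_deg_X[OF u(1)] finY by (simp add: arcs_between_out)
  show False using AB 1 2 rich by linarith
qed

text \<open>
  The absent arcs needed for the count come from the Hamiltonian cycle: a chord skipping exactly
  two of its vertices would itself close a cycle of the required length.
\<close>

lemma split_mergeable:
  assumes ham: "cyc E (y # x # ps)" and V: "set (y # x # ps) = V"
    and ps: "ps = (ps1 @ [w]) @ ps2" "ps1 @ [w] \<noteq> []" "ps2 \<noteq> []" "x \<in> X"
    and S: "cyc E (ps1 @ [w])" and T: "cyc E ps2"
  shows "\<exists>zs. cyc E zs \<and> length zs = length ps"
proof (rule ccontr)
  assume no: "\<not> ?thesis"
  define Sl where "Sl = ps1 @ [w]"
  have dis: "set Sl \<inter> set ps2 = {}" "x \<notin> set Sl \<union> set ps2" "y \<notin> set Sl \<union> set ps2" "x \<noteq> y"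
    using ham ps by (auto simp: cyc_def Sl_def)
  have y: "y \<in> Y" using ham ps(4) arc[of y x] disj by (auto simp: cyc_def)
  have part: "set Sl \<union> set ps2 \<union> {x, y} = V" using V ps by (auto simp: Sl_def)
  obtain g where g: "map g Sl = rotate1 Sl" "map g ps2 = rotate1 ps2"
  proof -
    have "pairwise (\<lambda>xs ys. set xs \<inter> set ys = {}) {Sl, ps2}"
      using dis(1) by (simp add: pairwise_insert Int_commute)
    moreover have "distinct xs" if "xs \<in> {Sl, ps2}" for xs using that S T by (auto simp: cyc_def Sl_def)
    ultimately show ?thesis using ex_succ[of "{Sl, ps2}"] that by blast
  qed
  have S: "cyc E Sl" using S by (simp add: Sl_def)
  note alt = cyc_alternating[OF S g(1)] cyc_alternating[OF T g(2)]
  \<comment> \<open>A merger would be a cycle on exactly the vertices of \<open>ps\<close>, which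
    \<open>no\<close> denies.\<close>
  have um: "unmergeable g (set Sl) (set ps2)"
    unfolding unmergeable_def
  proof (intro ballI notI)
    fix u v assume "u \<in> set Sl" "v \<in> set ps2" "E u (g v) \<and> E v (g u)"
    then obtain zs where zs: "cyc E zs" "set zs = set Sl \<union> set ps2"
      using cyc_merge[OF S g(1) T g(2) dis(1), of u v] by blast
    have "length zs = card (set zs)" using zs(1) by (simp add: cyc_def distinct_card)
    also have "\<dots> = card (set ps)" using zs(2) ps by (simp add: Sl_def)
    also have "\<dots> = length ps" using ham by (simp add: cyc_def distinct_card)
    finally show False using no zs(1) by blast
  qed
  then have um': "unmergeable g (set ps2) (set Sl)" unfolding unmergeable_def by blast
  have lenS: "length Sl = 2 * card (set Sl \<inter> X)" and lenT: "length ps2 = 2 * card (set ps2 \<inter> X)"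
    using card_cyc(2)[OF S] card_cyc(2)[OF T] by auto
  have ne: "Sl \<noteq> []" by (simp add: Sl_def)
  have pseq: "ps = Sl @ ps2" using ps by (simp add: Sl_def)
  show False
  \<comment> \<open>The count runs over the smaller cycle; the absent chords are found at the start
    of \<open>Sl\<close> or at the end of \<open>ps2\<close>.\<close>
  proof (cases "card (set Sl \<inter> X) \<le> card (set ps2 \<inter> X)")
    case True
    have "2 \<le> length Sl" using lenS ne by (cases "card (set Sl \<inter> X)") auto
    then obtain p0 p1 r where r: "Sl = p0 # p1 # r" by (cases Sl; cases "tl Sl") auto
    have p: "E p0 p1" "E x p0" "E y x" using ham r pseq by (auto simp: cyc_def)
    \<comment> \<open>This chord would skip exactly \<open>x\<close> and \<open>p0\<close>.\<close>
    have "\<not> E y p1"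
    proof
      assume "E y p1"
      then have "cyc E (y # p1 # r @ ps2)"
        using ham r pseq ps(3) by (auto simp: cyc_def successively_append_iff)
      then show False using no r pseq by fastforce
    qed
    moreover have "p1 \<in> X" using p arc ps(4) disj by blast
    moreover have "\<exists>p\<in>set Sl. \<exists>q\<in>set Sl. (p \<in> X \<longleftrightarrow> q \<in> Y) \<and> \<not> E p q" if "2 \<le> card (set Sl \<inter> X)"
    proof -
      have "4 \<le> length Sl" using lenS that by simp
      then obtain p2 p3 r' where r': "r = p2 # p3 # r'" using r by (cases r; cases "tl r") auto
      have p23: "E p1 p2" "E p2 p3" using ham r r' pseq by (auto simp: cyc_def)
      have "\<not> E p0 p3"
      proof
        assume "E p0 p3"
        then have "cyc E (y # x # p0 # p3 # r' @ ps2)"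
          using ham r r' pseq ps(3) by (auto simp: cyc_def successively_append_iff)
        then show False using no r r' pseq by fastforce
      qed
      moreover have "p0 \<in> X \<longleftrightarrow> p3 \<in> Y" using p p23 arc disj by blast
      ultimately show ?thesis using r r' by auto
    qed
    ultimately show False
      using near_factor_mergeable[OF part dis(1-3) ps(4) y alt _ True, of p1 y] um r y disj by auto
  next
    case False
    have "2 \<le> length ps2" using lenT ps(3) by (cases "card (set ps2 \<inter> X)") auto
    then obtain r t u where r: "ps2 = r @ [t, u]"
      by (cases ps2 rule: rev_cases; cases "butlast ps2" rule: rev_cases) auto
    have p: "E t u" "E u y" "E y x"
      using ham r pseq by (auto simp: cyc_def successively_append_iff successively_Cons)
    \<comment> \<open>Here the skipped vertices are \<open>u\<close> and \<open>y\<close>.\<close>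
    have "\<not> E t x"
    proof
      assume "E t x"
      then have "cyc E (x # Sl @ r @ [t])"
        using ham r pseq ne
          by (auto simp: cyc_def successively_append_iff successively_Cons hd_append split: if_splits)
      then show False using no r pseq by fastforce
    qed
    moreover have "t \<in> Y" using p arc ps(4) disj by blast
    moreover have inner: "\<exists>p\<in>set ps2. \<exists>q\<in>set ps2. (p \<in> X \<longleftrightarrow> q \<in> Y) \<and> \<not> E p q" if "2 \<le> card (set ps2 \<inter> X)"
    proof -
      have "4 \<le> length ps2" using lenT that by simp
      then obtain r' p0 p1 where r': "r = r' @ [p0, p1]"
        using r by (cases r rule: rev_cases; cases "butlast r" rule: rev_cases) auto
      have p01: "E p0 p1" "E p1 t"
        using ham r r' pseq by (auto simp: cyc_def successively_append_iff successively_Cons)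
      have "\<not> E p0 u"
      proof
        assume "E p0 u"
        then have "cyc E (y # x # Sl @ r' @ [p0, u])"
          using ham r r' pseq ne
          by (auto simp: cyc_def successively_append_iff successively_Cons hd_append split: if_splits)
        then show False using no r r' pseq by fastforce
      qed
      moreover have "p0 \<in> X \<longleftrightarrow> u \<in> Y" using p p01 arc disj by blast
      ultimately show ?thesis using r r' by auto
    qed
    moreover have "set ps2 \<union> set Sl \<union> {x, y} = V" using part by blast
    moreover have "set ps2 \<inter> set Sl = {}" "x \<notin> set ps2 \<union> set Sl" "y \<notin> set ps2 \<union> set Sl" using dis by auto
    moreover have "t \<in> set ps2" "set ps2 \<noteq> {}" "t \<in> X \<longleftrightarrow> x \<in> Y" using r \<open>t \<in> Y\<close> ps(4) disj by auto
    moreover have "card (set ps2 \<inter> X) \<le> card (set Sl \<inter> X)" using False by simp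
    ultimately show False
      using near_factor_mergeable[of "set ps2" "set Sl" x y g t x] ps(4) y alt um' by blast
  qed
qed

text \<open>The Hamiltonian cycle is written as \<open>y\<close>, \<open>x\<close>,
  \<open>ps\<close> with \<open>u\<close> at its end. Either \<open>u -> hd ps\<close> closes
  \<open>ps\<close>, or \<open>splitting_vertex\<close> cuts \<open>ps\<close> after
  \<open>w\<close> into two cycles, to which \<open>split_mergeable\<close> applies.\<close>

lemma near_hamiltonian_from:
  assumes "cyc E xs" "map f xs = rotate1 xs" "set xs = V" "u \<in> X"
    and rich: "a < ab {u} V + ab V {f (f (f u))}"
  shows "\<exists>zs. cyc E zs \<and> length zs + 2 = card V"
proof -
  obtain us where us: "cyc E (us @ [u])" "set (us @ [u]) = set xs" "length (us @ [u]) = length xs"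
      "hd (us @ [u]) = f u" "map f (us @ [u]) = rotate1 (us @ [u])"
    using cyc_ending_at[OF assms(1,2)] assms(3,4) by blast
  have len: "length xs = card V" using assms(1,3) by (simp add: cyc_def distinct_card[symmetric])
  have "card V = card X + card Y" using disj finX finY by (rule card_Un_disjoint[rotated 2])
  then have big: "int (length (us @ [u])) = 2 * a" using us(3) len cardX cardY by simp
  then have "4 \<le> length (us @ [u])" using k2 ka by linarith
  then obtain y x qs where qs: "us = y # x # qs" by (cases us; cases "tl us") auto
  define ps where "ps = qs @ [u]"
  have cy: "cyc E (y # x # ps)" and m: "map f (y # x # ps) = rotate1 (y # x # ps)"
    and setV: "set (y # x # ps) = V" and lenps: "length ps + 2 = card V"
    using us assms(3) len by (simp_all add: qs ps_def)
  have fy: "f y = x" and fx: "f x # map f ps = ps @ [y]" using m by auto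
  have fu: "f u = y" "f y = x" "f x = hd ps"
    using fx fy by (auto simp: ps_def Cons_eq_append_conv)
  have bij: "bij_betw f V V" using succ_bij[OF assms(2)] assms(3) by simp
  have arcs: "E v (f v)" if "v \<in> V" for v using cyc_succ[OF assms(1,2)] assms(3) that by simp
  have "cyc E ps" if "E u (hd ps)"
    using cy that by (auto simp: cyc_def ps_def successively_Cons)
  then have "E u (hd ps) \<Longrightarrow> ?thesis" using lenps by blast
  moreover have ?thesis if nE: "\<not> E u (hd ps)"
  proof -
    have xu: "x \<noteq> u" using cy by (auto simp: ps_def cyc_def)
    obtain w where w: "w \<in> X - {x, u}" "E w (hd ps)" "E u (f w)"
      using splitting_vertex[OF bij arcs assms(4) fu xu nE] rich fu by auto
    have "y \<in> Y" using arc[OF arcs[of u]] assms(4) fu disj by auto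
    then have "w \<in> set qs" using w setV disj by (auto simp: ps_def)
    then obtain ps1 r where r: "qs = ps1 @ w # r" by (meson split_list)
    define ps2 where "ps2 = r @ [u]"
    have pseq: "ps = (ps1 @ [w]) @ ps2" by (simp add: ps_def ps2_def r)
    have "map f ((y # x # ps1) @ w # ps2) = rotate1 ((y # x # ps1) @ w # ps2)"
      using m pseq by simp
    from succ_split[OF this] have fw: "f w = hd ps2" by (simp add: ps2_def hd_append)
    have x: "x \<in> X" using arc[OF arcs[of y]] \<open>y \<in> Y\<close> fu disj by auto
    have "cyc E (ps1 @ [w])"
      using cy w(2) unfolding pseq by (auto simp: cyc_def successively_Cons successively_append_iff hd_append)
    moreover have "cyc E ps2"
      using cy w(3) unfolding pseq fw by (auto simp: cyc_def successively_Cons successively_append_iff ps2_def)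
    ultimately show ?thesis
      using split_mergeable[OF cy setV pseq _ _ x] lenps by (auto simp: ps2_def)
  qed
  ultimately show ?thesis by blast
qed

lemma near_hamiltonian: "\<exists>zs. cyc E zs \<and> length zs + 2 = card V"
proof -
  interpret sw: dominating_bipartite E Y X a k by (rule swap)
  obtain xs where xs: "cyc E xs" "set xs = V" using hamiltonian by blast
  obtain f where f: "map f xs = rotate1 xs"
    using ex_succ[of "{xs}"] xs(1) by (auto simp: cyc_def)
  have bij: "bij_betw f V V" using succ_bij[OF f] xs(2) by simp
  have "bij_betw (f \<circ> (f \<circ> f)) V V" using bij by (intro bij_betw_trans)
  from ex_rich_chord[OF this] obtain u where u: "u \<in> V" "a < ab {u} V + ab V {f (f (f u))}" by auto
  show ?thesis
  proof (cases "u \<in> X")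
    case True
    then show ?thesis using near_hamiltonian_from[OF xs(1) f xs(2)] u by blast
  next
    case False
    have c: "Y \<union> X = V" by (rule Un_commute)
    have "u \<in> Y" using False u by blast
    then show ?thesis using sw.near_hamiltonian_from[OF xs(1) f, unfolded c, OF xs(2)] u by blast
  qed
qed

text \<open>For \<open>x\<close> off \<open>C\<close>, its in-neighbours on \<open>C\<close> and the
  vertices \<open>2 * r\<close> steps before its out-neighbours on \<open>C\<close> overlap, so
  \<open>v -> x -> (f ^^ (2 * r)) v\<close> for some \<open>v\<close>. Thus \<open>x\<close>
  replaces the \<open>2 * r - 1\<close> vertices in between.\<close>

lemma cyc_through_outer_vertex:
  assumes C: "cyc E C" and len: "length C + 2 = card V" and r: "1 \<le> r" "2 * r \<le> length C"
  shows "\<exists>zs. cyc E zs \<and> length zs + 2 * r = length C + 2"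
proof -
  obtain f where f: "map f C = rotate1 C"
    using ex_succ[of "{C}"] C by (auto simp: cyc_def)
  have alt: "alternating f (set C)" by (rule cyc_alternating[OF C f])
  note cc = card_cyc[OF C]
  have "card V = card X + card Y" using disj finX finY by (rule card_Un_disjoint[rotated 2])
  then have cardV: "int (card V) = 2 * a" using cardX cardY by simp
  have cX: "int (card (set C \<inter> X)) = a - 1" using len cc(2) cardV by linarith
  have cY: "int (card (set C \<inter> Y)) = a - 1" using cX cc(3) by simp
  have "set C \<inter> X \<noteq> X" using cX cardX by auto
  then obtain x where x: "x \<in> X" "x \<notin> set C" by blast
  define D where "D = set C \<inter> Y"
  have finD: "finite D" by (simp add: D_def)
  have "card (Y - D) = 1"
    using cY cardY finY by (subst card_Diff_subset) (auto simp: D_def)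
  then obtain y where y: "Y - D = {y}" by (meson card_1_singletonE)
  then have YD: "Y = insert y D" "y \<notin> D" by (auto simp: D_def)
  have out1: "card {w \<in> Y. E x w} \<le> Suc (card {w \<in> D. E x w})"
  proof -
    have "{w \<in> Y. E x w} \<subseteq> insert y {w \<in> D. E x w}" using YD by auto
    then have "card {w \<in> Y. E x w} \<le> card (insert y {w \<in> D. E x w})" using finD by (intro card_mono) auto
    then show ?thesis using finD by (simp add: card_insert_if split: if_splits)
  qed
  have in1: "card {w \<in> Y. E w x} \<le> Suc (card {w \<in> D. E w x})"
  proof -
    have "{w \<in> Y. E w x} \<subseteq> insert y {w \<in> D. E w x}" using YD by auto
    then have "card {w \<in> Y. E w x} \<le> card (insert y {w \<in> D. E w x})" using finD by (intro card_mono) auto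
    then show ?thesis using finD by (simp add: card_insert_if split: if_splits)
  qed
  have "a + k \<le> ab {x} Y + ab Y {x}" using semidegree_bounds(3)[OF x(1)] deg_ge[of x] x by simp
  then have deg: "a + k \<le> int (card {w \<in> D. E x w}) + int (card {w \<in> D. E w x}) + 2"
    using out1 in1 finY by (simp add: arcs_between_out arcs_between_in)
  have bijX: "bij_betw f (set C \<inter> X) (set C \<inter> Y)" and bijY: "bij_betw f (set C \<inter> Y) (set C \<inter> X)"
    using alternating_image(1-3)[OF alt] by (auto simp: bij_betw_def intro: inj_on_subset)
  have "bij_betw (f \<circ> f) D D" using bijY bijX unfolding D_def by (rule bij_betw_trans)
  then have bijr: "bij_betw ((f \<circ> f) ^^ r) D D" by (rule bij_betw_funpow)
  have pow: "((f \<circ> f) ^^ n) = f ^^ (2 * n)" for n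
    by (induction n) (auto simp: funpow_add fun_eq_iff)
  define B where "B = {v \<in> D. E x ((f ^^ (2 * r)) v)}"
  have "{w \<in> D. E x w} \<subseteq> (f ^^ (2 * r)) ` B"
  proof
    fix w assume w: "w \<in> {w \<in> D. E x w}"
    then obtain v where "v \<in> D" "w = (f ^^ (2 * r)) v"
      using bijr unfolding pow bij_betw_def by blast
    then show "w \<in> (f ^^ (2 * r)) ` B" using w by (auto simp: B_def)
  qed
  then have "card {w \<in> D. E x w} \<le> card B"
    using finD by (intro surj_card_le) (auto simp: B_def)
  moreover define A where "A = {w \<in> D. E w x}"
  \<comment> \<open>Passing from degrees to \<open>D\<close> loses at most the two arcs between
    \<open>x\<close> and \<open>y\<close>, and \<open>2 <= k\<close> makes up for them.\<close>
  ultimately have "a - 1 < int (card A) + int (card B)" using deg k2 by simp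
  moreover have "card (A \<union> B) \<le> card D" using finD by (intro card_mono) (auto simp: A_def B_def)
  moreover have "A \<inter> B = {} \<Longrightarrow> card (A \<union> B) = card A + card B"
    using finD by (intro card_Un_disjoint) (auto simp: A_def B_def)
  ultimately have "A \<inter> B \<noteq> {}" using cY by (auto simp: D_def)
  then obtain v where v: "v \<in> set C" "E v x" "E x ((f ^^ (2 * r)) v)" by (auto simp: A_def B_def D_def)
  obtain us where us: "cyc E (us @ [v])" "set (us @ [v]) = set C" "length (us @ [v]) = length C"
      "map f (us @ [v]) = rotate1 (us @ [v])"
    using cyc_ending_at[OF C f v(1)] by metis
  \<comment> \<open>The opened list begins with \<open>f v\<close>, so the vertex
    \<open>2 * r\<close> steps after \<open>v\<close> has index \<open>2 * r - 1\<close>.\<close>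
  define i where "i = 2 * r - 1"
  have i: "i < length (us @ [v])" "Suc i = 2 * r" using r us(3) by (auto simp: i_def)
  define L where "L = drop i us"
  have split: "us @ [v] = take i us @ (L @ [v])" by (simp add: L_def)
  have "hd (L @ [v]) = hd (drop i (us @ [v]))" using i(1) by (simp add: L_def)
  also have "\<dots> = (us @ [v]) ! i" using i(1) by (rule hd_drop_conv_nth)
  also have "\<dots> = (f ^^ (2 * r)) v" using nth_cyclic_list[OF us(4) i(1)] i(2) by simp
  finally have hd: "E x (hd (L @ [v]))" using v(3) by simp
  have "successively E (L @ [v])" "distinct (L @ [v])"
    using us(1) unfolding split cyc_def successively_append_iff distinct_append by blast+
  moreover have "x \<notin> set (L @ [v])" using x(2) us(2) by (auto simp: L_def dest: in_set_dropD)
  ultimately have "cyc E (x # L @ [v])" using hd v(2) by (simp add: cyc_def successively_Cons)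
  moreover have "length (x # L @ [v]) + 2 * r = length C + 2" using us(3) i by (simp add: L_def)
  ultimately show ?thesis by blast
qed

lemma all_even_cycles:
  assumes "even n" "2 \<le> n" "n \<le> card V"
  shows "\<exists>zs. cyc E zs \<and> length zs = n"
proof (cases "n = card V")
  case True
  obtain xs where "cyc E xs" "set xs = V" using hamiltonian by blast
  then show ?thesis using True distinct_card[of xs] by (auto simp: cyc_def)
next
  case False
  obtain C where C: "cyc E C" "length C + 2 = card V" using near_hamiltonian by blast
  have "even (length C)" using card_cyc(2)[OF C(1)] by simp
  then have "even (card V)" using C(2) by (metis even_add even_numeral)
  then have "even (card V - n)" using assms(1) by simp
  then obtain r where r: "length C + 2 = n + 2 * r"
    using assms(3) C(2) by (metis dvdE le_add_diff_inverse)
  have "n \<noteq> length C + 2" using False C(2) by simp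
  then show ?thesis
    using cyc_through_outer_vertex[OF C, of r] r assms(2) by auto
qed

end

section \<open>Back to digraphs\<close>

text \<open>Translates a cyclic vertex list into the arc list of the library's \<open>cycle\<close>;
  \<open>e\<close> selects the arc leaving each vertex.\<close>

lemma (in wf_digraph) cycle_map_arcs:
  assumes "xs \<noteq> []" "distinct xs" "map f xs = rotate1 xs"
    and e: "\<And>v. v \<in> set xs \<Longrightarrow> e v \<in> arcs G \<and> tail G (e v) = v \<and> head G (e v) = f v"
  shows "cycle (map e xs)"
proof -
  have cas: "cas (hd ys) (map e ys) z" if "ys \<noteq> []" "set ys \<subseteq> set xs" "map f ys = tl ys @ [z]" for ys z
    using that
  proof (induction ys)
    case (Cons y ys)
    then show ?case using e[of y] by (cases ys) auto
  qed simp
  have rot: "map f xs = tl xs @ [hd xs]" using assms(1,3) by (cases xs) auto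
  have last: "f (last xs) = hd xs" using assms(1) rot by (metis last_map last_snoc)
  have verts: "awalk_verts (hd xs) (map e xs) = xs @ [hd xs]"
    using assms(1) e last by (auto simp: awalk_verts_conv last_map intro: map_idI)
  have "hd xs \<in> verts G" using e[of "hd xs"] assms(1) tail_in_verts[of "e (hd xs)"] by simp
  then have "awalk (hd xs) (map e xs) (hd xs)"
    using cas[OF assms(1) _ rot] e by (auto simp: awalk_def)
  moreover have "distinct (tl (awalk_verts (hd xs) (map e xs)))"
    unfolding verts using assms(1,2) by (cases xs) auto
  ultimately show ?thesis using assms(1) unfolding cycle_def by blast
qed

lemma (in wf_digraph) ex_cycle_of_cyc:
  assumes "cyc (\<lambda>u v. u \<rightarrow>\<^bsub>G\<^esub> v) xs"
  shows "\<exists>p. cycle p \<and> length p = length xs"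
proof -
  obtain f where f: "map f xs = rotate1 xs"
    using ex_succ[of "{xs}"] assms by (auto simp: cyc_def)
  have "\<forall>v\<in>set xs. \<exists>c. c \<in> arcs G \<and> tail G c = v \<and> head G c = f v"
    using cyc_succ[OF assms f] by (auto elim!: reachableE)
  then obtain e where "\<And>v. v \<in> set xs \<Longrightarrow> e v \<in> arcs G \<and> tail G (e v) = v \<and> head G (e v) = f v"
    by metis
  then have "cycle (map e xs)" using assms f by (intro cycle_map_arcs) (auto simp: cyc_def)
  then show ?thesis by (intro exI[of _ "map e xs"]) simp
qed

text \<open>Without multiple arcs, \<open>head G\<close> is injective on the arcs leaving
  \<open>v\<close> and \<open>tail G\<close> on those entering it, so counting arcs amounts to
  counting neighbours.\<close>

lemma (in digraph) total_degree_eq_deg: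
  "int (total_degree G v) = deg (\<lambda>u v. u \<rightarrow>\<^bsub>G\<^esub> v) (verts G) v"
proof -
  have "card {w \<in> verts G. v \<rightarrow>\<^bsub>G\<^esub> w} = out_degree G v"
    unfolding out_degree_def out_arcs_def
    by (rule bij_betw_same_card[of "head G", symmetric])
      (auto simp: bij_betw_def inj_on_def arcs_ends_conv image_iff intro!: no_multi_arcs simp: arc_to_ends_def)
  moreover have "card {u \<in> verts G. u \<rightarrow>\<^bsub>G\<^esub> v} = in_degree G v"
    unfolding in_degree_def in_arcs_def
    by (rule bij_betw_same_card[of "tail G", symmetric])
      (auto simp: bij_betw_def inj_on_def arcs_ends_conv image_iff intro!: no_multi_arcs simp: arc_to_ends_def)
  ultimately show ?thesis
    by (simp add: total_degree_def deg_def arcs_between_out arcs_between_in)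
qed

section \<open>Strong connectivity and unique in-neighbours\<close>

lemma (in wf_digraph) arc_in_verts: "u \<rightarrow>\<^bsub>G\<^esub> v \<Longrightarrow> u \<in> verts G \<and> v \<in> verts G"
  by (auto simp: arcs_ends_conv)

lemma (in wf_digraph) strongly_connected_leave:
  assumes "strongly_connected G" "A \<subseteq> verts G" "A \<noteq> {}" "A \<noteq> verts G"
  shows "\<exists>u\<in>A. \<exists>v\<in>verts G - A. u \<rightarrow>\<^bsub>G\<^esub> v"
proof (rule ccontr)
  assume no: "\<not> ?thesis"
  obtain u v where u: "u \<in> A" and v: "v \<in> verts G" "v \<notin> A" using assms(2-4) by blast
  have "u \<rightarrow>\<^sup>*\<^bsub>G\<^esub> v" using assms(1,2) u v by (auto elim!: strongly_connectedE)
  then have "(u, v) \<in> (arcs_ends G)\<^sup>*" by (rule reachable_rtranclI)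
  then have "v \<in> A" using u no arc_in_verts by (induction rule: rtrancl_induct) blast+
  then show False using v by simp
qed

text \<open>Every vertex has an out-arc, and unique in-neighbours make the choice \<open>f\<close> a
  bijection to which all arcs belong. A cycle of \<open>f\<close> is then closed under arcs and
  exhausts the digraph.\<close>

lemma (in digraph) directed_cycle_if_in_unique:
  assumes sc: "strongly_connected G" and card: "2 \<le> card (verts G)"
    and uniq: "\<And>u v w. u \<rightarrow>\<^bsub>G\<^esub> w \<Longrightarrow> v \<rightarrow>\<^bsub>G\<^esub> w \<Longrightarrow> u = v"
  shows "is_directed_cycle G (card (verts G))"
proof -
  let ?E = "\<lambda>u v. u \<rightarrow>\<^bsub>G\<^esub> v"
  have "\<exists>w. v \<rightarrow>\<^bsub>G\<^esub> w" if "v \<in> verts G" for v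
  proof -
    have "card {v} \<noteq> card (verts G)" using card by simp
    then have "{v} \<noteq> verts G" by metis
    then show ?thesis using strongly_connected_leave[OF sc, of "{v}"] that by auto
  qed
  then obtain f where f: "\<And>v. v \<in> verts G \<Longrightarrow> v \<rightarrow>\<^bsub>G\<^esub> f v" by metis
  have "inj_on f (verts G)"
    using uniq[of _ "f _"] f by (intro inj_onI) metis
  moreover have "f ` verts G \<subseteq> verts G" using arc_in_verts[OF f] by auto
  ultimately have bij: "bij_betw f (verts G) (verts G)"
    by (simp add: bij_betw_def endo_inj_surj)
  have f_uniq: "w = f v" if "v \<rightarrow>\<^bsub>G\<^esub> w" for v w
  proof -
    have "w \<in> f ` verts G" using arc_in_verts[OF that] bij by (simp add: bij_betw_imp_surj_on)
    then obtain v' where "w = f v'" "v' \<in> verts G" by blast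
    then show ?thesis using f uniq that by metis
  qed
  obtain F where F: "cycle_factor ?E (verts G) F"
    using ex_cycle_factor[OF finite_verts bij, of ?E] f by blast
  obtain xs where xs: "xs \<in> F" using F card by (fastforce simp: cycle_factor_def)
  have cyc: "cyc ?E xs" using F xs by (simp add: cycle_factor_def)
  have sub: "set xs \<subseteq> verts G" using F xs by (auto simp: cycle_factor_def)
  obtain g where g: "map g xs = rotate1 xs"
    using ex_succ[of "{xs}"] cyc by (auto simp: cyc_def)
  have "g v = f v" if "v \<in> set xs" for v using cyc_succ[OF cyc g that] f_uniq by simp
  then have fxs: "map f xs = rotate1 xs" using g by (metis map_cong)
  have fset: "f v \<in> set xs" if "v \<in> set xs" for v
    using that succ_bij[OF fxs] by (auto simp: bij_betw_def)
  have V: "set xs = verts G"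
  proof (rule ccontr)
    assume "set xs \<noteq> verts G"
    then show False
      using strongly_connected_leave[OF sc sub] cyc f_uniq fset by (auto simp: cyc_def)
  qed
  have "\<forall>v\<in>verts G. \<exists>c. c \<in> arcs G \<and> tail G c = v \<and> head G c = f v"
    using f by (auto elim!: reachableE)
  then obtain e where e: "\<And>v. v \<in> verts G \<Longrightarrow> e v \<in> arcs G \<and> tail G (e v) = v \<and> head G (e v) = f v"
    by metis
  have "cycle (map e xs)" using cyc fxs e V by (intro cycle_map_arcs) (auto simp: cyc_def)
  moreover have "length (map e xs) = card (verts G)"
    using cyc V by (simp add: cyc_def distinct_card[symmetric])
  moreover have "arcs G = set (map e xs)"
  proof
    show "arcs G \<subseteq> set (map e xs)"
    proof
      fix c assume c: "c \<in> arcs G"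
      then have "tail G c \<rightarrow>\<^bsub>G\<^esub> head G c" by (auto simp: arcs_ends_conv)
      then have "head G c = f (tail G c)" by (rule f_uniq)
      moreover have t: "tail G c \<in> verts G" using c by simp
      ultimately have "c = e (tail G c)" using c e[OF t] by (intro no_multi_arcs) (auto simp: arc_to_ends_def)
      then show "c \<in> set (map e xs)" using t V by auto
    qed
    show "set (map e xs) \<subseteq> arcs G" using e V by auto
  qed
  moreover have "verts G = tail G ` set (map e xs)" using e V by (auto simp: image_image image_iff)
  ultimately show ?thesis unfolding is_directed_cycle_def by blast
qed

text \<open>The set \<open>Q\<close> of vertices in no dominating pair is closed under arcs: an
  out-neighbour of such a vertex has no other in-neighbour, so \<open>low\<close> applies to it. By
  strong connectivity \<open>Q\<close> is everything.\<close>

lemma (in digraph) in_unique_if_undominating_vertex: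
  assumes sc: "strongly_connected G"
    and low: "\<And>v w. v \<rightarrow>\<^bsub>G\<^esub> w \<Longrightarrow> (\<And>u. u \<rightarrow>\<^bsub>G\<^esub> w \<Longrightarrow> u = v) \<Longrightarrow> (\<And>u. \<not> dominating_pair G w u)"
    and v: "v \<in> verts G" "\<And>u. \<not> dominating_pair G v u"
    and arcs: "u \<rightarrow>\<^bsub>G\<^esub> w" "u' \<rightarrow>\<^bsub>G\<^esub> w"
  shows "u = u'"
proof -
  define Q where "Q = {v \<in> verts G. \<forall>u. \<not> dominating_pair G v u}"
  have uniq: "p = q" if "q \<in> Q" "p \<rightarrow>\<^bsub>G\<^esub> r" "q \<rightarrow>\<^bsub>G\<^esub> r" for p q r
    using that arc_in_verts unfolding Q_def dominating_pair_def by blast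
  have "Q = verts G"
  proof (rule ccontr)
    assume "Q \<noteq> verts G"
    moreover have "Q \<subseteq> verts G" "Q \<noteq> {}" using v by (auto simp: Q_def)
    ultimately obtain p r where pr: "p \<in> Q" "r \<in> verts G - Q" "p \<rightarrow>\<^bsub>G\<^esub> r"
      using strongly_connected_leave[OF sc] by blast
    have "u = p" if "u \<rightarrow>\<^bsub>G\<^esub> r" for u using uniq[OF pr(1) that pr(3)] .
    then have "\<not> dominating_pair G r u" for u using low[OF pr(3)] by blast
    then show False using pr(2) by (simp add: Q_def)
  qed
  then have "u' \<in> Q" using arc_in_verts[OF arcs(2)] by simp
  then show ?thesis using arcs by (rule uniq)
qed

theorem theorem1p5:
  fixes D :: "('a, 'b) pre_digraph" and a :: nat and k :: int
  assumes "digraph D"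
    and "strongly_connected D"
    and "balanced_bipartite D"
    and "card (verts D) = 2 * a"
    and "a \<ge> 3"
    and "max 1 (real a / 4) < real_of_int k"
    and "real_of_int k \<le> real a / 2"
    and "\<And>u v. dominating_pair D u v \<Longrightarrow>
           (int (total_degree D u) \<ge> 2 * int a - k \<and> int (total_degree D v) \<ge> int a + k) \<or>
           (int (total_degree D u) \<ge> int a + k \<and> int (total_degree D v) \<ge> 2 * int a - k)"
  shows "bipancyclic D \<or> is_directed_cycle D (2 * a)"
proof -
  interpret digraph D by (rule assms(1))
  let ?E = "\<lambda>u v. u \<rightarrow>\<^bsub>D\<^esub> v"
  \<comment> \<open>Integrality turns \<open>1 < k\<close> into \<open>2 <= k\<close>.\<close>
  have k: "2 \<le> k" "2 * k \<le> int a" "int a < 4 * k" using assms(6,7) by linarith+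
  obtain X Y where XY: "X \<union> Y = verts D" "X \<inter> Y = {}" "card X = card Y"
    and ends: "\<And>e. e \<in> arcs D \<Longrightarrow> tail D e \<in> X \<and> head D e \<in> Y \<or> tail D e \<in> Y \<and> head D e \<in> X"
    using assms(3) unfolding balanced_bipartite_def bipartition_def by metis
  have fin: "finite X" "finite Y" using XY(1) finite_verts by (metis finite_Un)+
  have "card X + card Y = 2 * a"
    using card_Un_disjoint[OF fin XY(2)] XY(1) assms(4) by simp
  then have card: "card X = a" "card Y = a" using XY(3) by auto
  have arc: "u \<in> X \<and> v \<in> Y \<or> u \<in> Y \<and> v \<in> X" if "u \<rightarrow>\<^bsub>D\<^esub> v" for u v
    using that ends by (auto elim!: reachableE)
  note deg = total_degree_eq_deg
  have dom_ge: "int a + k \<le> int (total_degree D v)" if "dominating_pair D v u" for u v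
    using assms(8)[OF that] k by auto
  show ?thesis
  proof (cases "\<exists>v\<in>verts D. \<forall>u. \<not> dominating_pair D v u")
    case True
    then obtain v0 where v0: "v0 \<in> verts D" "\<And>u. \<not> dominating_pair D v0 u" by blast
    \<comment> \<open>With in-degree 1 the degree of \<open>w\<close> is at most
      \<open>a + 1\<close>, below the \<open>a + k\<close> required in a dominating pair.\<close>
    have low: "\<not> dominating_pair D w u"
      if "v \<rightarrow>\<^bsub>D\<^esub> w" "\<And>u. u \<rightarrow>\<^bsub>D\<^esub> w \<Longrightarrow> u = v" for v w u
    proof
      assume "dominating_pair D w u"
      then have "int a + k \<le> deg ?E (verts D) w" using dom_ge deg by metis
      moreover have "card {u \<in> verts D. u \<rightarrow>\<^bsub>D\<^esub> w} \<le> card {v}"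
        using that(2) by (intro card_mono) auto
      moreover have "card {x \<in> verts D. w \<rightarrow>\<^bsub>D\<^esub> x} \<le> a"
      proof (cases "w \<in> X")
        case True
        then have "card {x \<in> verts D. w \<rightarrow>\<^bsub>D\<^esub> x} \<le> card Y"
          using fin arc XY(2) by (intro card_mono) auto
        then show ?thesis using card by simp
      next
        case False
        then have "card {x \<in> verts D. w \<rightarrow>\<^bsub>D\<^esub> x} \<le> card X"
          using fin arc by (intro card_mono) auto
        then show ?thesis using card by simp
      qed
      ultimately show False
        using k by (simp add: deg_def arcs_between_out arcs_between_in)
    qed
    have "is_directed_cycle D (card (verts D))"
    proof (rule directed_cycle_if_in_unique[OF assms(2)])
      show "u = v" if "u \<rightarrow>\<^bsub>D\<^esub> w" "v \<rightarrow>\<^bsub>D\<^esub> w" for u v w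
        using in_unique_if_undominating_vertex[OF assms(2) low v0 that] .
    qed (use assms(4,5) in simp)
    then show ?thesis using assms(4) by simp
  next
    case False
    interpret dominating_bipartite ?E X Y "int a" k
    proof
      show "u \<in> X \<and> v \<in> Y \<or> u \<in> Y \<and> v \<in> X" if "u \<rightarrow>\<^bsub>D\<^esub> v" for u v by (rule arc[OF that])
      show "int a + k \<le> deg ?E (X \<union> Y) v" if "v \<in> X \<union> Y" for v
        using False that dom_ge deg unfolding XY(1) by metis
      show "2 * int a - k \<le> deg ?E (X \<union> Y) u \<or> 2 * int a - k \<le> deg ?E (X \<union> Y) v"
        if "u \<rightarrow>\<^bsub>D\<^esub> w" "v \<rightarrow>\<^bsub>D\<^esub> w" "u \<noteq> v" for u v w
      proof -
        have "dominating_pair D u v"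
          using that arc_in_verts unfolding dominating_pair_def by blast
        from assms(8)[OF this] show ?thesis unfolding XY(1) deg by blast
      qed
      show "\<exists>u\<in>A. \<exists>v\<in>X \<union> Y - A. u \<rightarrow>\<^bsub>D\<^esub> v" if "A \<subseteq> X \<union> Y" "A \<noteq> {}" "A \<noteq> X \<union> Y" for A
        using strongly_connected_leave[OF assms(2)] that unfolding XY(1) by blast
    qed (use fin card XY(2) k in simp_all)
    have "bipancyclic D"
      unfolding bipancyclic_def
    proof (intro allI impI)
      fix n assume n: "even n \<and> 2 \<le> n \<and> n \<le> card (verts D)"
      then obtain zs where "cyc ?E zs" "length zs = n"
        using all_even_cycles[of n] unfolding XY(1) by blast
      then show "\<exists>p. pre_digraph.cycle D p \<and> length p = n" using ex_cycle_of_cyc by blast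
    qed
    then show ?thesis ..
  qed
qed

end
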